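(* Let $(A_i,\cdot_i,\ast_i,\alpha_i)$ be admissible Hom-Novikov-Poisson algebras for $i=1,2$, and let $A=A_1\otimes A_2$ be the Hom-Novikov-Poisson algebra with twisting map $\alpha=\alpha_1\otimes\alpha_2$ and operations \[ (x_1\otimes x_2)\cdot(y_1\otimes y_2)=(x_1\cdot_1 y_1)\otimes(x_2\cdot_2 y_2), \] \[ (x_1\otimes x_2)\ast(y_1\otimes y_2)=(x_1\ast_1 y_1)\otimes(x_2\cdot_2 y_2)+(x_1\cdot_1 y_1)\otimes(x_2\ast_2 y_2) \] for $x_i,y_i\in A_i$. Then $A$ is admissible.
   Context: Everything is over a fixed field $\mathbf{k}$ of characteristic $0$; $\otimes$ is over $\mathbf{k}$. A double Hom-algebra is a quadruple $(A,\cdot,\ast,\alpha)$ where $A$ is a $\mathbf{k}$-vector space, $\cdot$ and $\ast$ are bilinear operations $A\otimes A\to A$, and $\alpha\colon A\to A$ is a linear map (the twisting map). A Hom-Novikov-Poisson algebra is a double Hom-algebra $(A,\cdot,\ast,\alpha)$ such that for all $x,y,z\in A$: (1) $(A,\cdot,\alpha)$ is a commutative Hom-associative algebra: $x\cdot y=y\cdot x$ and $(x\cdot y)\cdot\alpha(z)=\alpha(x)\cdot(y\cdot z)$; (2) $(A,\ast,\alpha)$ is a Hom-Novikov algebra: $(x\ast y)\ast\alpha(z)-\alpha(x)\ast(y\ast z)=(y\ast x)\ast\alpha(z)-\alpha(y)\ast(x\ast z)$ and $(x\ast y)\ast\alpha(z)=(x\ast z)\ast\alpha(y)$; (3) $(x\ast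 y)\cdot\alpha(z)-\alpha(x)\ast(y\cdot z)=(y\ast x)\cdot\alpha(z)-\alpha(y)\ast(x\cdot z)$; (4) $(x\cdot y)\ast\alpha(z)=(x\ast z)\cdot\alpha(y)$. It is a result of the paper that the tensor product $A$ with the operations in the claim is a Hom-Novikov-Poisson algebra whenever $A_1$ and $A_2$ are. A Hom-Lie algebra $(A,[,],\alpha)$ is a vector space with a bilinear anti-symmetric bracket and a linear map $\alpha$ satisfying the Hom-Jacobi identity $[[x,y],\alpha(z)]+[[z,x],\alpha(y)]+[[y,z],\alpha(x)]=0$. A Hom-Poisson algebra $(A,\cdot,[,],\alpha)$ consists of a commutative Hom-associative algebra $(A,\cdot,\alpha)$ and a Hom-Lie algebra $(A,[,],\alpha)$ such that the Hom-Leibniz identity $[\alpha(x),y\cdot z]=[x,y]\cdot\alpha(z)+\alpha(y)\cdot[x,z]$ holds for all $x,y,z\in A$. A Hom-Novikov-Poisson algebra $(A,\cdot,\ast,\alpha)$ is admissible if $A^-=(A,\cdot,[,],\alpha)$ is a Hom-Poisson algebra, where $[x,y]=x\ast y-y\ast x$. *)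

theory Defs
  imports "HOL-Algebra.AbelCoset" "HOL-Algebra.Module"
begin

section \<open>Linear and bilinear maps\<close>

definition linear_map ::
    "('k, 'r) ring_scheme \<Rightarrow> ('k, 'a, 'm) module_scheme \<Rightarrow> ('k, 'b, 'n) module_scheme
      \<Rightarrow> ('a \<Rightarrow> 'b) \<Rightarrow> bool" where
  "linear_map K M N f \<longleftrightarrow>
     f \<in> carrier M \<rightarrow> carrier N \<and>
     (\<forall>x\<in>carrier M. \<forall>y\<in>carrier M. f (x \<oplus>\<^bsub>M\<^esub> y) = f x \<oplus>\<^bsub>N\<^esub> f y) \<and>
     (\<forall>a\<in>carrier K. \<forall>x\<in>carrier M. f (a \<odot>\<^bsub>M\<^esub> x) = a \<odot>\<^bsub>N\<^esub> f x)"

definition bilinear_map ::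
    "('k, 'r) ring_scheme \<Rightarrow> ('k, 'a, 'm) module_scheme \<Rightarrow> ('k, 'b, 'n) module_scheme
      \<Rightarrow> ('k, 'c, 'p) module_scheme \<Rightarrow> ('a \<Rightarrow> 'b \<Rightarrow> 'c) \<Rightarrow> bool" where
  "bilinear_map K M N P f \<longleftrightarrow>
     (\<forall>x\<in>carrier M. linear_map K N P (f x)) \<and>
     (\<forall>y\<in>carrier N. linear_map K M P (\<lambda>x. f x y))"


section \<open>Hom-algebras\<close>

locale hom_algebra = field K + module K A for K (structure) and A (structure) +
  fixes mul :: "'c \<Rightarrow> 'c \<Rightarrow> 'c" (infixl \<open>\<bullet>\<close> 70) and \<alpha> :: "'c \<Rightarrow> 'c"
  assumes char_0: "\<And>n::nat. 0 < n \<Longrightarrow> [n] \<cdot>\<^bsub>K\<^esub> \<one>\<^bsub>K\<^esub> \<noteq> \<zero>\<^bsub>K\<^esub>"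
    and bilinear: "bilinear_map K A A A (\<bullet>)"
    and twist_linear: "linear_map K A A \<alpha>"

locale comm_hom_associative_algebra = hom_algebra K A mul \<alpha>
  for K (structure) and A (structure) and mul (infixl \<open>\<bullet>\<close> 70) and \<alpha> +
  assumes commutative: "\<lbrakk>x \<in> carrier A; y \<in> carrier A\<rbrakk> \<Longrightarrow> x \<bullet> y = y \<bullet> x"
    and hom_associative:
      "\<lbrakk>x \<in> carrier A; y \<in> carrier A; z \<in> carrier A\<rbrakk> \<Longrightarrow> (x \<bullet> y) \<bullet> \<alpha> z = \<alpha> x \<bullet> (y \<bullet> z)"

locale hom_novikov_algebra = hom_algebra K A mul \<alpha>
  for K (structure) and A (structure) and mul (infixl \<open>\<star>\<close> 70) and \<alpha> +
  assumes hom_left_symmetric: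
      "\<lbrakk>x \<in> carrier A; y \<in> carrier A; z \<in> carrier A\<rbrakk> \<Longrightarrow>
        ((x \<star> y) \<star> \<alpha> z) \<ominus>\<^bsub>A\<^esub> (\<alpha> x \<star> (y \<star> z)) = ((y \<star> x) \<star> \<alpha> z) \<ominus>\<^bsub>A\<^esub> (\<alpha> y \<star> (x \<star> z))"
    and hom_right_commutative:
      "\<lbrakk>x \<in> carrier A; y \<in> carrier A; z \<in> carrier A\<rbrakk> \<Longrightarrow> (x \<star> y) \<star> \<alpha> z = (x \<star> z) \<star> \<alpha> y"

locale hom_novikov_poisson_algebra =
  comm_hom_associative_algebra K A dot \<alpha> + Nov: hom_novikov_algebra K A star \<alpha>
  for K (structure) and A (structure)
    and dot (infixl \<open>\<bullet>\<close> 70) and star (infixl \<open>\<star>\<close> 70) and \<alpha> +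
  assumes star_dot_compatible:
      "\<lbrakk>x \<in> carrier A; y \<in> carrier A; z \<in> carrier A\<rbrakk> \<Longrightarrow>
        ((x \<star> y) \<bullet> \<alpha> z) \<ominus>\<^bsub>A\<^esub> (\<alpha> x \<star> (y \<bullet> z)) = ((y \<star> x) \<bullet> \<alpha> z) \<ominus>\<^bsub>A\<^esub> (\<alpha> y \<star> (x \<bullet> z))"
    and dot_star_compatible:
      "\<lbrakk>x \<in> carrier A; y \<in> carrier A; z \<in> carrier A\<rbrakk> \<Longrightarrow> (x \<bullet> y) \<star> \<alpha> z = (x \<star> z) \<bullet> \<alpha> y"

locale hom_lie_algebra = hom_algebra K A br \<alpha>
  for K (structure) and A (structure) and br (\<open>\<lbrace>_, _\<rbrace>\<close>) and \<alpha> +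
  assumes antisymmetric: "\<lbrakk>x \<in> carrier A; y \<in> carrier A\<rbrakk> \<Longrightarrow> \<lbrace>x, y\<rbrace> = \<ominus>\<^bsub>A\<^esub> \<lbrace>y, x\<rbrace>"
    and hom_jacobi:
      "\<lbrakk>x \<in> carrier A; y \<in> carrier A; z \<in> carrier A\<rbrakk> \<Longrightarrow>
        \<lbrace>\<lbrace>x, y\<rbrace>, \<alpha> z\<rbrace> \<oplus>\<^bsub>A\<^esub> \<lbrace>\<lbrace>z, x\<rbrace>, \<alpha> y\<rbrace> \<oplus>\<^bsub>A\<^esub> \<lbrace>\<lbrace>y, z\<rbrace>, \<alpha> x\<rbrace> = \<zero>\<^bsub>A\<^esub>"

locale hom_poisson_algebra =
  comm_hom_associative_algebra K A dot \<alpha> + Lie: hom_lie_algebra K A br \<alpha>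
  for K (structure) and A (structure)
    and dot (infixl \<open>\<bullet>\<close> 70) and br (\<open>\<lbrace>_, _\<rbrace>\<close>) and \<alpha> +
  assumes hom_leibniz:
      "\<lbrakk>x \<in> carrier A; y \<in> carrier A; z \<in> carrier A\<rbrakk> \<Longrightarrow>
        \<lbrace>\<alpha> x, y \<bullet> z\<rbrace> = (\<lbrace>x, y\<rbrace> \<bullet> \<alpha> z) \<oplus>\<^bsub>A\<^esub> (\<alpha> y \<bullet> \<lbrace>x, z\<rbrace>)"

locale admissible_hom_novikov_poisson_algebra = hom_novikov_poisson_algebra K A dot star \<alpha>
  for K (structure) and A (structure)
    and dot (infixl \<open>\<bullet>\<close> 70) and star (infixl \<open>\<star>\<close> 70) and \<alpha> +
  assumes admissible: "hom_poisson_algebra K A (\<bullet>) (\<lambda>x y. (x \<star> y) \<ominus>\<^bsub>A\<^esub> (y \<star> x)) \<alpha>"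


section \<open>Tensor products\<close>

text \<open>
  The tensor product of \<open>M\<close> and \<open>N\<close> is the free module on \<open>carrier M \<times> carrier N\<close> (finitely
  supported functions) modulo the submodule generated by the bilinearity relations.
  In the records below \<open>mult\<close> and \<open>one\<close> are not part of the module structure.
\<close>

definition free_module :: "('k, 'r) ring_scheme \<Rightarrow> 's set \<Rightarrow> ('k, 's \<Rightarrow> 'k) module" where
  "free_module K S =
     \<lparr>carrier = {u. u \<in> UNIV \<rightarrow> carrier K \<and> finite {s. u s \<noteq> \<zero>\<^bsub>K\<^esub>} \<and> {s. u s \<noteq> \<zero>\<^bsub>K\<^esub>} \<subseteq> S},
      mult = undefined, one = undefined,
      zero = (\<lambda>s. \<zero>\<^bsub>K\<^esub>), add = (\<lambda>u v s. u s \<oplus>\<^bsub>K\<^esub> v s),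
      smult = (\<lambda>a u s. a \<otimes>\<^bsub>K\<^esub> u s)\<rparr>"

definition free_gen :: "('k, 'r) ring_scheme \<Rightarrow> 's \<Rightarrow> 's \<Rightarrow> 'k" where
  "free_gen K s = (\<lambda>t. if t = s then \<one>\<^bsub>K\<^esub> else \<zero>\<^bsub>K\<^esub>)"

definition quotient_module ::
    "('k, 'a, 'm) module_scheme \<Rightarrow> 'a set \<Rightarrow> ('k, 'a set) module" where
  "quotient_module M H =
     \<lparr>carrier = a_rcosets\<^bsub>M\<^esub> H,
      mult = undefined, one = undefined,
      zero = H, add = set_add M,
      smult = (\<lambda>a X. \<Union>x\<in>X. H +>\<^bsub>M\<^esub> (a \<odot>\<^bsub>M\<^esub> x))\<rparr>"

definition generated_submodule ::
    "('k, 'r) ring_scheme \<Rightarrow> ('k, 'a, 'm) module_scheme \<Rightarrow> 'a set \<Rightarrow> 'a set" where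
  "generated_submodule K M X = \<Inter>{H. submodule H K M \<and> X \<subseteq> H}"

definition tensor_relations ::
    "('k, 'r) ring_scheme \<Rightarrow> ('k, 'a, 'm) module_scheme \<Rightarrow> ('k, 'b, 'n) module_scheme
      \<Rightarrow> ('a \<times> 'b \<Rightarrow> 'k) set" where
  "tensor_relations K M N =
    (let F = free_module K (carrier M \<times> carrier N); e = (\<lambda>x y. free_gen K (x, y)) in
       {e (x \<oplus>\<^bsub>M\<^esub> x') y \<ominus>\<^bsub>F\<^esub> (e x y \<oplus>\<^bsub>F\<^esub> e x' y) | x x' y.
          x \<in> carrier M \<and> x' \<in> carrier M \<and> y \<in> carrier N}
     \<union> {e x (y \<oplus>\<^bsub>N\<^esub> y') \<ominus>\<^bsub>F\<^esub> (e x y \<oplus>\<^bsub>F\<^esub> e x y') | x y y'.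
          x \<in> carrier M \<and> y \<in> carrier N \<and> y' \<in> carrier N}
     \<union> {e (a \<odot>\<^bsub>M\<^esub> x) y \<ominus>\<^bsub>F\<^esub> (a \<odot>\<^bsub>F\<^esub> e x y) | a x y.
          a \<in> carrier K \<and> x \<in> carrier M \<and> y \<in> carrier N}
     \<union> {e x (a \<odot>\<^bsub>N\<^esub> y) \<ominus>\<^bsub>F\<^esub> (a \<odot>\<^bsub>F\<^esub> e x y) | a x y.
          a \<in> carrier K \<and> x \<in> carrier M \<and> y \<in> carrier N})"

definition tensor_kernel ::
    "('k, 'r) ring_scheme \<Rightarrow> ('k, 'a, 'm) module_scheme \<Rightarrow> ('k, 'b, 'n) module_scheme
      \<Rightarrow> ('a \<times> 'b \<Rightarrow> 'k) set" where
  "tensor_kernel K M N =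
     generated_submodule K (free_module K (carrier M \<times> carrier N)) (tensor_relations K M N)"

definition tensor_product ::
    "('k, 'r) ring_scheme \<Rightarrow> ('k, 'a, 'm) module_scheme \<Rightarrow> ('k, 'b, 'n) module_scheme
      \<Rightarrow> ('k, ('a \<times> 'b \<Rightarrow> 'k) set) module" where
  "tensor_product K M N =
     quotient_module (free_module K (carrier M \<times> carrier N)) (tensor_kernel K M N)"

definition pure_tensor ::
    "('k, 'r) ring_scheme \<Rightarrow> ('k, 'a, 'm) module_scheme \<Rightarrow> ('k, 'b, 'n) module_scheme
      \<Rightarrow> 'a \<Rightarrow> 'b \<Rightarrow> ('a \<times> 'b \<Rightarrow> 'k) set" where
  "pure_tensor K M N x y =
     tensor_kernel K M N +>\<^bsub>free_module K (carrier M \<times> carrier N)\<^esub> free_gen K (x, y)"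

text \<open>
  The linear map \<open>M \<otimes> N \<rightarrow> P\<close> induced by a bilinear map \<open>g\<close>: extend \<open>g\<close> linearly to the free
  module and evaluate at a representative of the coset. For bilinear \<open>g\<close> the choice of the
  representative is irrelevant (\<open>lift_pure\<close>, \<open>lift_linear\<close> below).
\<close>

definition tensor_lift ::
    "('k, 'r) ring_scheme \<Rightarrow> ('k, 'c, 'p) module_scheme \<Rightarrow> ('a \<Rightarrow> 'b \<Rightarrow> 'c)
      \<Rightarrow> ('a \<times> 'b \<Rightarrow> 'k) set \<Rightarrow> 'c" where
  "tensor_lift K P g X =
     (let u = (SOME u. u \<in> X) in
       \<Oplus>\<^bsub>P\<^esub> s \<in> {s. u s \<noteq> \<zero>\<^bsub>K\<^esub>}. u s \<odot>\<^bsub>P\<^esub> g (fst s) (snd s))"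

text \<open>\<open>(f \<otimes> g) (x\<^sub>1 \<otimes> x\<^sub>2) = f x\<^sub>1 \<otimes> g x\<^sub>2\<close>\<close>

definition tensor_map ::
    "('k, 'r) ring_scheme \<Rightarrow> ('k, 'a, 'm) module_scheme \<Rightarrow> ('k, 'b, 'n) module_scheme
      \<Rightarrow> ('a \<Rightarrow> 'a) \<Rightarrow> ('b \<Rightarrow> 'b) \<Rightarrow> ('a \<times> 'b \<Rightarrow> 'k) set \<Rightarrow> ('a \<times> 'b \<Rightarrow> 'k) set" where
  "tensor_map K M N f g =
     tensor_lift K (tensor_product K M N) (\<lambda>x\<^sub>1 x\<^sub>2. pure_tensor K M N (f x\<^sub>1) (g x\<^sub>2))"

text \<open>\<open>(x\<^sub>1 \<otimes> x\<^sub>2, y\<^sub>1 \<otimes> y\<^sub>2) \<mapsto> f x\<^sub>1 y\<^sub>1 \<otimes> g x\<^sub>2 y\<^sub>2\<close>, extended bilinearly\<close>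

definition tensor_op ::
    "('k, 'r) ring_scheme \<Rightarrow> ('k, 'a, 'm) module_scheme \<Rightarrow> ('k, 'b, 'n) module_scheme
      \<Rightarrow> ('a \<Rightarrow> 'a \<Rightarrow> 'a) \<Rightarrow> ('b \<Rightarrow> 'b \<Rightarrow> 'b)
      \<Rightarrow> ('a \<times> 'b \<Rightarrow> 'k) set \<Rightarrow> ('a \<times> 'b \<Rightarrow> 'k) set \<Rightarrow> ('a \<times> 'b \<Rightarrow> 'k) set" where
  "tensor_op K M N f g X Y =
     tensor_lift K (tensor_product K M N)
       (\<lambda>x\<^sub>1 x\<^sub>2. tensor_lift K (tensor_product K M N)
          (\<lambda>y\<^sub>1 y\<^sub>2. pure_tensor K M N (f x\<^sub>1 y\<^sub>1) (g x\<^sub>2 y\<^sub>2)) Y) X"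

definition tensor_star ::
    "('k, 'r) ring_scheme \<Rightarrow> ('k, 'a, 'm) module_scheme \<Rightarrow> ('k, 'b, 'n) module_scheme
      \<Rightarrow> ('a \<Rightarrow> 'a \<Rightarrow> 'a) \<Rightarrow> ('a \<Rightarrow> 'a \<Rightarrow> 'a) \<Rightarrow> ('b \<Rightarrow> 'b \<Rightarrow> 'b) \<Rightarrow> ('b \<Rightarrow> 'b \<Rightarrow> 'b)
      \<Rightarrow> ('a \<times> 'b \<Rightarrow> 'k) set \<Rightarrow> ('a \<times> 'b \<Rightarrow> 'k) set \<Rightarrow> ('a \<times> 'b \<Rightarrow> 'k) set" where
  "tensor_star K M N dot\<^sub>1 star\<^sub>1 dot\<^sub>2 star\<^sub>2 X Y =
     tensor_op K M N star\<^sub>1 dot\<^sub>2 X Y \<oplus>\<^bsub>tensor_product K M N\<^esub> tensor_op K M N dot\<^sub>1 star\<^sub>2 X Y"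


section \<open>The induced operations on pure tensors\<close>

lemma free_module_sel [simp]:
  "carrier (free_module K S) =
     {u. u \<in> UNIV \<rightarrow> carrier K \<and> finite {s. u s \<noteq> \<zero>\<^bsub>K\<^esub>} \<and> {s. u s \<noteq> \<zero>\<^bsub>K\<^esub>} \<subseteq> S}"
  "\<zero>\<^bsub>free_module K S\<^esub> = (\<lambda>s. \<zero>\<^bsub>K\<^esub>)"
  "u \<oplus>\<^bsub>free_module K S\<^esub> v = (\<lambda>s. u s \<oplus>\<^bsub>K\<^esub> v s)"
  "a \<odot>\<^bsub>free_module K S\<^esub> u = (\<lambda>s. a \<otimes>\<^bsub>K\<^esub> u s)"
  by (simp_all add: free_module_def)

lemma free_module_memI:
  assumes "\<And>s. u s \<in> carrier K" "{s. u s \<noteq> \<zero>\<^bsub>K\<^esub>} \<subseteq> A" "finite A" "A \<subseteq> S"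
  shows "u \<in> carrier (free_module K S)"
  using assms finite_subset[OF assms(2,3)] by auto

lemma (in cring) module_free_module: "module R (free_module R S)"
proof (rule moduleI)
  show "cring R" by (rule cring_axioms)
  show "abelian_group (free_module R S)"
  proof (rule abelian_groupI)
    fix u v assume "u \<in> carrier (free_module R S)" "v \<in> carrier (free_module R S)"
    then show "u \<oplus>\<^bsub>free_module R S\<^esub> v \<in> carrier (free_module R S)"
      by (intro free_module_memI[where A = "{s. u s \<noteq> \<zero>} \<union> {s. v s \<noteq> \<zero>}"]) (auto simp: Pi_def)
  next
    fix u assume u: "u \<in> carrier (free_module R S)"
    have "(\<lambda>s. \<ominus> u s) \<in> carrier (free_module R S)"
      using u by (intro free_module_memI[where A = "{s. u s \<noteq> \<zero>}"]) (auto simp: Pi_def)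
    then show "\<exists>v\<in>carrier (free_module R S). v \<oplus>\<^bsub>free_module R S\<^esub> u = \<zero>\<^bsub>free_module R S\<^esub>"
      using u by (intro bexI[of _ "\<lambda>s. \<ominus> u s"]) (auto simp: l_neg Pi_def)
  qed (auto simp: Pi_def a_ac)
  fix a u assume "a \<in> carrier R" "u \<in> carrier (free_module R S)"
  then show "a \<odot>\<^bsub>free_module R S\<^esub> u \<in> carrier (free_module R S)"
    by (intro free_module_memI[where A = "{s. u s \<noteq> \<zero>}"]) (auto simp: Pi_def)
qed (auto simp: Pi_def l_distr r_distr m_assoc)

lemma (in cring) free_gen_closed: "s \<in> S \<Longrightarrow> free_gen R s \<in> carrier (free_module R S)"
  by (intro free_module_memI[where A = "{s}"]) (auto simp: free_gen_def)

lemma (in module) submodule_generated: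
  assumes "X \<subseteq> carrier M"
  shows "submodule (generated_submodule R M X) R M"
    and "X \<subseteq> generated_submodule R M X"
    and "submodule H R M \<Longrightarrow> X \<subseteq> H \<Longrightarrow> generated_submodule R M X \<subseteq> H"
proof -
  have c: "submodule (carrier M) R M" by (rule carrier_is_submodule)
  show "submodule (generated_submodule R M X) R M"
  proof (rule submoduleI)
    show "generated_submodule R M X \<subseteq> carrier M"
      using c assms by (auto simp: generated_submodule_def)
    show "\<zero>\<^bsub>M\<^esub> \<in> generated_submodule R M X"
      by (auto simp: generated_submodule_def dest!: submodule.axioms(1) subgroup.one_closed)
  qed (auto simp: generated_submodule_def dest: submoduleE)
qed (auto simp: generated_submodule_def)

lemma (in module) abelian_subgroup_submodule:
  "submodule H R M \<Longrightarrow> abelian_subgroup H M"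
  by (intro abelian_subgroupI3 additive_subgroupI M.abelian_group_axioms submodule.axioms(1))

lemma (in module) quotient_module_smult:
  assumes H: "submodule H R M" and "a \<in> carrier R" "x \<in> carrier M"
  shows "a \<odot>\<^bsub>quotient_module M H\<^esub> (H +>\<^bsub>M\<^esub> x) = H +>\<^bsub>M\<^esub> (a \<odot>\<^bsub>M\<^esub> x)"
proof -
  interpret H: abelian_subgroup H M by (rule abelian_subgroup_submodule[OF H])
  have *: "H +>\<^bsub>M\<^esub> (a \<odot>\<^bsub>M\<^esub> y) = H +>\<^bsub>M\<^esub> (a \<odot>\<^bsub>M\<^esub> x)" if y: "y \<in> H +>\<^bsub>M\<^esub> x" for y
  proof -
    obtain h where h: "h \<in> H" "y = h \<oplus>\<^bsub>M\<^esub> x"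
      using y by (auto simp: a_r_coset_def')
    have "a \<odot>\<^bsub>M\<^esub> y = a \<odot>\<^bsub>M\<^esub> h \<oplus>\<^bsub>M\<^esub> a \<odot>\<^bsub>M\<^esub> x"
      using h assms H.a_subset by (auto simp: smult_r_distr)
    moreover have "a \<odot>\<^bsub>M\<^esub> h \<in> H" using submoduleE(4)[OF H] h assms by blast
    ultimately have "a \<odot>\<^bsub>M\<^esub> y \<in> H +>\<^bsub>M\<^esub> (a \<odot>\<^bsub>M\<^esub> x)" by (auto simp: a_r_coset_def')
    then show ?thesis
      using a_repr_independence[OF _ _ H.a_subgroup] assms by auto
  qed
  have "(\<Union>y\<in>H +>\<^bsub>M\<^esub> x. H +>\<^bsub>M\<^esub> (a \<odot>\<^bsub>M\<^esub> y)) = (\<Union>y\<in>H +>\<^bsub>M\<^esub> x. H +>\<^bsub>M\<^esub> (a \<odot>\<^bsub>M\<^esub> x))"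
    by (rule SUP_cong[OF refl *])
  also have "\<dots> = H +>\<^bsub>M\<^esub> (a \<odot>\<^bsub>M\<^esub> x)"
    using H.a_rcos_self[OF assms(3)] by blast
  finally show ?thesis
    by (simp add: quotient_module_def)
qed

lemma (in module) quotient_module_add:
  assumes H: "submodule H R M" and "x \<in> carrier M" "y \<in> carrier M"
  shows "(H +>\<^bsub>M\<^esub> x) \<oplus>\<^bsub>quotient_module M H\<^esub> (H +>\<^bsub>M\<^esub> y) = H +>\<^bsub>M\<^esub> (x \<oplus>\<^bsub>M\<^esub> y)"
proof -
  interpret H: abelian_subgroup H M by (rule abelian_subgroup_submodule[OF H])
  show ?thesis using assms by (simp add: quotient_module_def H.a_rcos_sum)
qed

lemma quotient_module_carrier:
  "carrier (quotient_module M H) = (\<lambda>x. H +>\<^bsub>M\<^esub> x) ` carrier M"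
  by (auto simp: quotient_module_def A_RCOSETS_def')

lemma (in module) module_quotient_module:
  assumes H: "submodule H R M"
  shows "module R (quotient_module M H)"
proof -
  interpret H: abelian_subgroup H M by (rule abelian_subgroup_submodule[OF H])
  have z: "\<zero>\<^bsub>quotient_module M H\<^esub> = H +>\<^bsub>M\<^esub> \<zero>\<^bsub>M\<^esub>"
    using H.a_subset by (simp add: quotient_module_def)
  note Q = quotient_module_add[OF H] quotient_module_smult[OF H]
  show ?thesis
  proof (rule moduleI; (unfold quotient_module_carrier z, (elim imageE)?, (hypsubst)?)?)
    show "cring R" by (rule R.cring_axioms)
    show "abelian_group (quotient_module M H)"
    proof (rule abelian_groupI; unfold quotient_module_carrier z; (elim imageE)?; hypsubst?)
      fix x assume x: "x \<in> carrier M"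
      then have "(H +>\<^bsub>M\<^esub> (\<ominus>\<^bsub>M\<^esub> x)) \<oplus>\<^bsub>quotient_module M H\<^esub> (H +>\<^bsub>M\<^esub> x) = H +>\<^bsub>M\<^esub> \<zero>\<^bsub>M\<^esub>"
        by (simp only: Q M.a_inv_closed M.l_neg)
      with x show "\<exists>Y\<in>(\<lambda>x. H +>\<^bsub>M\<^esub> x) ` carrier M. Y \<oplus>\<^bsub>quotient_module M H\<^esub> (H +>\<^bsub>M\<^esub> x) = H +>\<^bsub>M\<^esub> \<zero>\<^bsub>M\<^esub>"
        by blast
    qed (simp_all only: Q M.a_closed M.zero_closed M.l_zero M.r_zero imageI M.a_ac)
  qed (simp_all only: Q M.a_closed R.a_closed R.m_closed R.one_closed smult_closed smult_l_distr
      smult_r_distr smult_assoc1 smult_one imageI)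
qed

locale tensor = M?: module K M + N?: module K N
  for K (structure) and M (structure) and N (structure)
begin

abbreviation "F \<equiv> free_module K (carrier M \<times> carrier N)"
abbreviation "T \<equiv> tensor_product K M N"
abbreviation pt (infixl \<open>\<otimes>\<^sub>T\<close> 75) where "x \<otimes>\<^sub>T y \<equiv> pure_tensor K M N x y"

sublocale F: module K F
  by (rule M.R.module_free_module)

lemma gen_closed [simp]:
  "x \<in> carrier M \<Longrightarrow> y \<in> carrier N \<Longrightarrow> free_gen K (x, y) \<in> carrier F"
  by (rule M.R.free_gen_closed) auto

lemma tensor_relations_closed: "tensor_relations K M N \<subseteq> carrier F"
  unfolding tensor_relations_def Let_def
  by (auto simp del: free_module_sel)

lemmas kernel_gen = F.submodule_generated[OF tensor_relations_closed, folded tensor_kernel_def]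

sublocale ker: abelian_subgroup "tensor_kernel K M N" F
  by (rule F.abelian_subgroup_submodule[OF kernel_gen(1)])

sublocale T: module K T
  unfolding tensor_product_def by (rule F.module_quotient_module[OF kernel_gen(1)])

lemma carrier_T: "carrier T = (\<lambda>u. tensor_kernel K M N +>\<^bsub>F\<^esub> u) ` carrier F"
  by (simp add: tensor_product_def quotient_module_carrier del: free_module_sel)

lemma add_T: "u \<in> carrier F \<Longrightarrow> v \<in> carrier F \<Longrightarrow>
  (tensor_kernel K M N +>\<^bsub>F\<^esub> u) \<oplus>\<^bsub>T\<^esub> (tensor_kernel K M N +>\<^bsub>F\<^esub> v) = tensor_kernel K M N +>\<^bsub>F\<^esub> (u \<oplus>\<^bsub>F\<^esub> v)"
  unfolding tensor_product_def by (rule F.quotient_module_add[OF kernel_gen(1)])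

lemma smult_T: "a \<in> carrier K \<Longrightarrow> u \<in> carrier F \<Longrightarrow>
  a \<odot>\<^bsub>T\<^esub> (tensor_kernel K M N +>\<^bsub>F\<^esub> u) = tensor_kernel K M N +>\<^bsub>F\<^esub> (a \<odot>\<^bsub>F\<^esub> u)"
  unfolding tensor_product_def by (rule F.quotient_module_smult[OF kernel_gen(1)])

lemma coset_eqI:
  assumes "u \<ominus>\<^bsub>F\<^esub> v \<in> tensor_kernel K M N" "u \<in> carrier F" "v \<in> carrier F"
  shows "tensor_kernel K M N +>\<^bsub>F\<^esub> u = tensor_kernel K M N +>\<^bsub>F\<^esub> v"
  using assms by (metis F.M.a_coset_add_inv1 F.M.a_coset_join2 F.M.minus_closed
      F.M.minus_eq ker.a_subgroup ker.a_subset)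

lemma pure_tensor_closed [simp]:
  "x \<in> carrier M \<Longrightarrow> y \<in> carrier N \<Longrightarrow> x \<otimes>\<^sub>T y \<in> carrier T"
  using gen_closed unfolding carrier_T pure_tensor_def by blast

lemma bilinear_pure_tensor: "bilinear_map K M N T (\<lambda>x y. x \<otimes>\<^sub>T y)"
proof -
  note rel = subsetD[OF kernel_gen(2)]
  note [simp del] = free_module_sel
  have 1: "(x \<oplus>\<^bsub>M\<^esub> x') \<otimes>\<^sub>T y = x \<otimes>\<^sub>T y \<oplus>\<^bsub>T\<^esub> x' \<otimes>\<^sub>T y"
    if "x \<in> carrier M" "x' \<in> carrier M" "y \<in> carrier N" for x x' y
    unfolding pure_tensor_def using that
    by (simp add: add_T, intro coset_eqI rel) (auto simp: tensor_relations_def Let_def)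
  have 2: "x \<otimes>\<^sub>T (y \<oplus>\<^bsub>N\<^esub> y') = x \<otimes>\<^sub>T y \<oplus>\<^bsub>T\<^esub> x \<otimes>\<^sub>T y'"
    if "x \<in> carrier M" "y' \<in> carrier N" "y \<in> carrier N" for x y' y
    unfolding pure_tensor_def using that
    by (simp add: add_T, intro coset_eqI rel) (auto simp: tensor_relations_def Let_def)
  have 3: "(a \<odot>\<^bsub>M\<^esub> x) \<otimes>\<^sub>T y = a \<odot>\<^bsub>T\<^esub> x \<otimes>\<^sub>T y"
    if "a \<in> carrier K" "x \<in> carrier M" "y \<in> carrier N" for a x y
    unfolding pure_tensor_def using that
    by (simp add: smult_T, intro coset_eqI rel) (auto simp: tensor_relations_def Let_def)
  have 4: "x \<otimes>\<^sub>T (a \<odot>\<^bsub>N\<^esub> y) = a \<odot>\<^bsub>T\<^esub> x \<otimes>\<^sub>T y"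
    if "a \<in> carrier K" "x \<in> carrier M" "y \<in> carrier N" for a x y
    unfolding pure_tensor_def using that
    by (simp add: smult_T, intro coset_eqI rel) (auto simp: tensor_relations_def Let_def)
  show ?thesis
    using 1 2 3 4 by (auto simp: bilinear_map_def linear_map_def)
qed

end

lemma linear_mapD:
  assumes "linear_map K M N f"
  shows "x \<in> carrier M \<Longrightarrow> f x \<in> carrier N"
    and "x \<in> carrier M \<Longrightarrow> y \<in> carrier M \<Longrightarrow> f (x \<oplus>\<^bsub>M\<^esub> y) = f x \<oplus>\<^bsub>N\<^esub> f y"
    and "a \<in> carrier K \<Longrightarrow> x \<in> carrier M \<Longrightarrow> f (a \<odot>\<^bsub>M\<^esub> x) = a \<odot>\<^bsub>N\<^esub> f x"
  using assms by (auto simp: linear_map_def)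

lemma bilinear_mapD:
  assumes "bilinear_map K M N P f"
  shows "x \<in> carrier M \<Longrightarrow> linear_map K N P (f x)"
    and "y \<in> carrier N \<Longrightarrow> linear_map K M P (\<lambda>x. f x y)"
  using assms by (auto simp: bilinear_map_def)

locale tensor_universal = tensor K M N + P?: module K P
  for K (structure) and M (structure) and N (structure) and P (structure)
begin

definition ext where
  "ext g u = (\<Oplus>\<^bsub>P\<^esub> s \<in> {s. u s \<noteq> \<zero>\<^bsub>K\<^esub>}. u s \<odot>\<^bsub>P\<^esub> g (fst s) (snd s))"

context
  fixes g assumes g: "\<And>x y. x \<in> carrier M \<Longrightarrow> y \<in> carrier N \<Longrightarrow> g x y \<in> carrier P"
begin

lemma ext_superset:
  assumes "u \<in> carrier F" "finite A" "{s. u s \<noteq> \<zero>\<^bsub>K\<^esub>} \<subseteq> A" "A \<subseteq> carrier M \<times> carrier N"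
  shows "ext g u = (\<Oplus>\<^bsub>P\<^esub> s \<in> A. u s \<odot>\<^bsub>P\<^esub> g (fst s) (snd s))"
  unfolding ext_def using assms g
  by (intro P.M.add.finprod_mono_neutral_cong_left) (auto simp: Pi_def)

lemma ext_linear: "linear_map K F P (ext g)"
  unfolding linear_map_def
proof (intro conjI ballI funcsetI)
  fix u assume u: "u \<in> carrier F"
  show "ext g u \<in> carrier P"
    unfolding ext_def using u g by (intro P.M.finsum_closed) (auto simp: Pi_def)
  {
    fix v assume v: "v \<in> carrier F"
    let ?A = "{s. u s \<noteq> \<zero>\<^bsub>K\<^esub>} \<union> {s. v s \<noteq> \<zero>\<^bsub>K\<^esub>}"
    have A: "finite ?A" "?A \<subseteq> carrier M \<times> carrier N" using u v by auto
    have "{s. (u \<oplus>\<^bsub>F\<^esub> v) s \<noteq> \<zero>\<^bsub>K\<^esub>} \<subseteq> ?A" by auto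
    from ext_superset[OF F.M.a_closed[OF u v] A(1) this A(2)]
    have "ext g (u \<oplus>\<^bsub>F\<^esub> v) = (\<Oplus>\<^bsub>P\<^esub> s \<in> ?A. (u s \<oplus>\<^bsub>K\<^esub> v s) \<odot>\<^bsub>P\<^esub> g (fst s) (snd s))" by simp
    also have "\<dots> = (\<Oplus>\<^bsub>P\<^esub> s \<in> ?A. u s \<odot>\<^bsub>P\<^esub> g (fst s) (snd s) \<oplus>\<^bsub>P\<^esub> v s \<odot>\<^bsub>P\<^esub> g (fst s) (snd s))"
      using u v A g by (intro P.M.finsum_cong') (auto simp: Pi_def P.smult_l_distr)
    also have "\<dots> = ext g u \<oplus>\<^bsub>P\<^esub> ext g v"
      using u v A g
      by (subst P.M.finsum_addf) (auto simp: Pi_def ext_superset[OF u A(1) _ A(2)] ext_superset[OF v A(1) _ A(2)])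
    finally show "ext g (u \<oplus>\<^bsub>F\<^esub> v) = ext g u \<oplus>\<^bsub>P\<^esub> ext g v" .
  }
next
  fix a u assume a: "a \<in> carrier K" and u: "u \<in> carrier F"
  let ?A = "{s. u s \<noteq> \<zero>\<^bsub>K\<^esub>}"
  have A: "finite ?A" "?A \<subseteq> carrier M \<times> carrier N" using u by auto
  have "{s. (a \<odot>\<^bsub>F\<^esub> u) s \<noteq> \<zero>\<^bsub>K\<^esub>} \<subseteq> ?A" using a by auto
  from ext_superset[OF F.smult_closed[OF a u] A(1) this A(2)]
  have "ext g (a \<odot>\<^bsub>F\<^esub> u) = (\<Oplus>\<^bsub>P\<^esub> s \<in> ?A. (a \<otimes>\<^bsub>K\<^esub> u s) \<odot>\<^bsub>P\<^esub> g (fst s) (snd s))" by simp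
  also have "\<dots> = (\<Oplus>\<^bsub>P\<^esub> s \<in> ?A. a \<odot>\<^bsub>P\<^esub> (u s \<odot>\<^bsub>P\<^esub> g (fst s) (snd s)))"
    using u a A g by (intro P.M.finsum_cong') (auto simp: Pi_def P.smult_assoc1)
  also have "\<dots> = a \<odot>\<^bsub>P\<^esub> ext g u"
    unfolding ext_def
    using u a A g by (subst P.finsum_smult_ldistr) (auto simp: Pi_def)
  finally show "ext g (a \<odot>\<^bsub>F\<^esub> u) = a \<odot>\<^bsub>P\<^esub> ext g u" .
qed

lemma ext_gen:
  assumes "x \<in> carrier M" "y \<in> carrier N"
  shows "ext g (free_gen K (x, y)) = g x y"
proof -
  have "ext g (free_gen K (x, y)) = (\<Oplus>\<^bsub>P\<^esub> s \<in> {(x, y)}. free_gen K (x, y) s \<odot>\<^bsub>P\<^esub> g (fst s) (snd s))"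
    using assms by (intro ext_superset gen_closed) (auto simp: free_gen_def split: if_splits)
  also have "\<dots> = g x y"
    using assms g by (simp add: free_gen_def)
  finally show ?thesis .
qed

end

lemma linear_map_minus:
  assumes f: "linear_map K F P f" and "u \<in> carrier F" "v \<in> carrier F"
  shows "f (u \<ominus>\<^bsub>F\<^esub> v) = f u \<ominus>\<^bsub>P\<^esub> f v"
proof -
  have "f (u \<ominus>\<^bsub>F\<^esub> v) \<oplus>\<^bsub>P\<^esub> f v = f ((u \<ominus>\<^bsub>F\<^esub> v) \<oplus>\<^bsub>F\<^esub> v)"
    using assms by (simp add: linear_mapD(2)[OF f] del: free_module_sel)
  also have "(u \<ominus>\<^bsub>F\<^esub> v) \<oplus>\<^bsub>F\<^esub> v = u"
    using assms by (simp add: F.M.minus_eq F.M.a_assoc F.M.l_neg del: free_module_sel)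
  finally show ?thesis
    using assms linear_mapD(1)[OF f]
    by (metis F.M.minus_closed P.M.add.inv_solve_right P.M.minus_eq)
qed

context
  fixes g assumes bil: "bilinear_map K M N P g"
begin

lemma g_closed: "x \<in> carrier M \<Longrightarrow> y \<in> carrier N \<Longrightarrow> g x y \<in> carrier P"
  using bil by (auto simp: bilinear_map_def linear_map_def)

lemma lin: "linear_map K F P (ext g)"
  by (rule ext_linear) (rule g_closed)

lemma ext_kernel:
  assumes "u \<in> tensor_kernel K M N"
  shows "ext g u = \<zero>\<^bsub>P\<^esub>"
proof -
  note [simp del] = free_module_sel
  let ?H = "{u \<in> carrier F. ext g u = \<zero>\<^bsub>P\<^esub>}"
  note L = linear_mapD[OF lin]
  have "\<zero>\<^bsub>F\<^esub> = \<zero>\<^bsub>K\<^esub> \<odot>\<^bsub>F\<^esub> \<zero>\<^bsub>F\<^esub>" by simp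
  then have z: "ext g \<zero>\<^bsub>F\<^esub> = \<zero>\<^bsub>P\<^esub>"
    by (metis F.M.zero_closed M.R.zero_closed L(1,3) P.smult_l_null)
  have neg: "ext g (\<ominus>\<^bsub>F\<^esub> u) = \<ominus>\<^bsub>P\<^esub> ext g u" if "u \<in> carrier F" for u
    using linear_map_minus[OF lin F.M.zero_closed that] that z L(1)[OF that]
    by (simp add: F.M.minus_eq P.M.minus_eq)
  have "submodule ?H K F"
    by (rule F.submoduleI) (auto simp: z neg L)
  moreover have "tensor_relations K M N \<subseteq> ?H"
    using bil
    by (auto simp: tensor_relations_def Let_def linear_map_minus[OF lin] L ext_gen g_closed
        bilinear_map_def linear_map_def P.M.minus_eq P.M.r_neg)
  ultimately show ?thesis using kernel_gen(3) assms by blast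
qed

lemma lift_coset:
  assumes u: "u \<in> carrier F"
  shows "tensor_lift K P g (tensor_kernel K M N +>\<^bsub>F\<^esub> u) = ext g u"
proof -
  note [simp del] = free_module_sel
  let ?X = "tensor_kernel K M N +>\<^bsub>F\<^esub> u"
  have "(SOME v. v \<in> ?X) \<in> ?X"
    using ker.a_rcos_self[OF u] by (rule someI[where P = "\<lambda>v. v \<in> ?X"])
  then obtain h where h: "h \<in> tensor_kernel K M N" "(SOME v. v \<in> ?X) = h \<oplus>\<^bsub>F\<^esub> u"
    by (auto simp: a_r_coset_def')
  then have hF: "h \<in> carrier F" using ker.a_subset by blast
  have "tensor_lift K P g ?X = ext g (h \<oplus>\<^bsub>F\<^esub> u)"
    unfolding tensor_lift_def Let_def ext_def h(2) ..
  also have "\<dots> = ext g u"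
    using linear_mapD[OF lin] hF u ext_kernel[OF h(1)] by simp
  finally show ?thesis .
qed

lemma lift_pure:
  "x \<in> carrier M \<Longrightarrow> y \<in> carrier N \<Longrightarrow> tensor_lift K P g (x \<otimes>\<^sub>T y) = g x y"
  by (simp add: pure_tensor_def lift_coset ext_gen g_closed del: free_module_sel)

lemma lift_linear: "linear_map K T P (tensor_lift K P g)"
  using linear_mapD[OF lin]
  by (auto simp: linear_map_def carrier_T add_T smult_T lift_coset simp del: free_module_sel)

end

lemma lift_linear_param:
  fixes Q (structure)
  assumes Q: "module K Q" and X: "X \<in> carrier T"
    and bil: "\<And>q. q \<in> carrier Q \<Longrightarrow> bilinear_map K M N P (h q)"
    and lin: "\<And>x y. x \<in> carrier M \<Longrightarrow> y \<in> carrier N \<Longrightarrow> linear_map K Q P (\<lambda>q. h q x y)"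
  shows "linear_map K Q P (\<lambda>q. tensor_lift K P (h q) X)"
proof -
  interpret Q: module K Q by (rule Q)
  obtain u where u: "u \<in> carrier F" "X = tensor_kernel K M N +>\<^bsub>F\<^esub> u"
    using X unfolding carrier_T by blast
  let ?A = "{s. u s \<noteq> \<zero>\<^bsub>K\<^esub>}"
  have A: "finite ?A" "?A \<subseteq> carrier M \<times> carrier N" and uK: "\<And>s. u s \<in> carrier K"
    using u by auto
  have lift: "tensor_lift K P (h q) X = (\<Oplus>\<^bsub>P\<^esub> s \<in> ?A. u s \<odot>\<^bsub>P\<^esub> h q (fst s) (snd s))"
    if "q \<in> carrier Q" for q
    using lift_coset[OF bil[OF that] u(1)] by (simp add: u(2) ext_def)
  have L: "h q (fst s) (snd s) \<in> carrier P"
      "q' \<in> carrier Q \<Longrightarrow> h (q \<oplus>\<^bsub>Q\<^esub> q') (fst s) (snd s) = h q (fst s) (snd s) \<oplus>\<^bsub>P\<^esub> h q' (fst s) (snd s)"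
      "a \<in> carrier K \<Longrightarrow> h (a \<odot>\<^bsub>Q\<^esub> q) (fst s) (snd s) = a \<odot>\<^bsub>P\<^esub> h q (fst s) (snd s)"
    if "s \<in> ?A" "q \<in> carrier Q" for s q q' a
    using linear_mapD[OF lin[of "fst s" "snd s"]] that A(2) by auto
  show ?thesis
    unfolding linear_map_def
  proof (intro conjI ballI funcsetI)
    fix q assume q: "q \<in> carrier Q"
    show "tensor_lift K P (h q) X \<in> carrier P"
      unfolding lift[OF q] by (intro P.M.finsum_closed Pi_I P.smult_closed uK L q)
    {
      fix q' assume q': "q' \<in> carrier Q"
      have "tensor_lift K P (h (q \<oplus>\<^bsub>Q\<^esub> q')) X =
          (\<Oplus>\<^bsub>P\<^esub> s \<in> ?A. u s \<odot>\<^bsub>P\<^esub> h q (fst s) (snd s) \<oplus>\<^bsub>P\<^esub> u s \<odot>\<^bsub>P\<^esub> h q' (fst s) (snd s))"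
        unfolding lift[OF Q.M.a_closed[OF q q']]
        by (rule P.M.finsum_cong') (use q q' uK L in \<open>simp_all add: Pi_def P.smult_r_distr del: split_paired_All\<close>)
      also have "\<dots> = tensor_lift K P (h q) X \<oplus>\<^bsub>P\<^esub> tensor_lift K P (h q') X"
        unfolding lift[OF q] lift[OF q']
        by (rule P.M.finsum_addf) (use q q' uK L in \<open>simp_all add: Pi_def del: split_paired_All\<close>)
      finally show "tensor_lift K P (h (q \<oplus>\<^bsub>Q\<^esub> q')) X =
        tensor_lift K P (h q) X \<oplus>\<^bsub>P\<^esub> tensor_lift K P (h q') X" .
    }
  next
    fix a q assume a: "a \<in> carrier K" and q: "q \<in> carrier Q"
    have "tensor_lift K P (h (a \<odot>\<^bsub>Q\<^esub> q)) X =
        (\<Oplus>\<^bsub>P\<^esub> s \<in> ?A. a \<odot>\<^bsub>P\<^esub> (u s \<odot>\<^bsub>P\<^esub> h q (fst s) (snd s)))"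
      unfolding lift[OF Q.smult_closed[OF a q]]
      by (rule P.M.finsum_cong')
        (use a q uK L in \<open>simp_all add: Pi_def P.smult_assoc1[symmetric] M.R.m_comm del: split_paired_All\<close>)
    also have "\<dots> = a \<odot>\<^bsub>P\<^esub> tensor_lift K P (h q) X"
      unfolding lift[OF q]
      by (rule P.finsum_smult_ldistr[symmetric]) (use a q uK L A in \<open>simp_all add: Pi_def del: split_paired_All\<close>)
    finally show "tensor_lift K P (h (a \<odot>\<^bsub>Q\<^esub> q)) X = a \<odot>\<^bsub>P\<^esub> tensor_lift K P (h q) X" .
  qed
qed

end

context tensor
begin

interpretation U: tensor_universal K M N T ..

lemma bilinear_pure_tensor_comp:
  assumes "linear_map K M M f" "linear_map K N N g"
  shows "bilinear_map K M N T (\<lambda>x y. f x \<otimes>\<^sub>T g y)"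
  using bilinear_pure_tensor assms by (simp add: bilinear_map_def linear_map_def Pi_def)

theorem tensor_map_linear:
  assumes "linear_map K M M f" "linear_map K N N g"
  shows "linear_map K T T (tensor_map K M N f g)"
  unfolding tensor_map_def by (rule U.lift_linear[OF bilinear_pure_tensor_comp[OF assms]])

theorem tensor_map_pure:
  assumes "linear_map K M M f" "linear_map K N N g" "x \<in> carrier M" "y \<in> carrier N"
  shows "tensor_map K M N f g (x \<otimes>\<^sub>T y) = f x \<otimes>\<^sub>T g y"
  unfolding tensor_map_def
  by (rule U.lift_pure[OF bilinear_pure_tensor_comp[OF assms(1,2)] assms(3,4)])

context
  fixes f g
  assumes f: "bilinear_map K M M M f" and g: "bilinear_map K N N N g"
begin

lemma inner_bilinear:
  "x\<^sub>1 \<in> carrier M \<Longrightarrow> x\<^sub>2 \<in> carrier N \<Longrightarrow>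
    bilinear_map K M N T (\<lambda>y\<^sub>1 y\<^sub>2. f x\<^sub>1 y\<^sub>1 \<otimes>\<^sub>T g x\<^sub>2 y\<^sub>2)"
  by (intro bilinear_pure_tensor_comp bilinear_mapD(1)[OF f] bilinear_mapD(1)[OF g])

lemma inner_bilinear':
  "y\<^sub>1 \<in> carrier M \<Longrightarrow> y\<^sub>2 \<in> carrier N \<Longrightarrow>
    bilinear_map K M N T (\<lambda>x\<^sub>1 x\<^sub>2. f x\<^sub>1 y\<^sub>1 \<otimes>\<^sub>T g x\<^sub>2 y\<^sub>2)"
  by (intro bilinear_pure_tensor_comp bilinear_mapD(2)[OF f] bilinear_mapD(2)[OF g])

lemma outer_bilinear:
  assumes "Y \<in> carrier T"
  shows "bilinear_map K M N T
    (\<lambda>x\<^sub>1 x\<^sub>2. tensor_lift K T (\<lambda>y\<^sub>1 y\<^sub>2. f x\<^sub>1 y\<^sub>1 \<otimes>\<^sub>T g x\<^sub>2 y\<^sub>2) Y)"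
  unfolding bilinear_map_def
  by (intro conjI ballI U.lift_linear_param M.module_axioms N.module_axioms assms inner_bilinear)
    (auto dest: bilinear_mapD[OF inner_bilinear'])

theorem tensor_op_pure:
  assumes "x\<^sub>1 \<in> carrier M" "x\<^sub>2 \<in> carrier N" "y\<^sub>1 \<in> carrier M" "y\<^sub>2 \<in> carrier N"
  shows "tensor_op K M N f g (x\<^sub>1 \<otimes>\<^sub>T x\<^sub>2) (y\<^sub>1 \<otimes>\<^sub>T y\<^sub>2) = f x\<^sub>1 y\<^sub>1 \<otimes>\<^sub>T g x\<^sub>2 y\<^sub>2"
  unfolding tensor_op_def
  using assms U.lift_pure[OF outer_bilinear, of "y\<^sub>1 \<otimes>\<^sub>T y\<^sub>2" x\<^sub>1 x\<^sub>2]
    U.lift_pure[OF inner_bilinear, of x\<^sub>1 x\<^sub>2 y\<^sub>1 y\<^sub>2] by simp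

theorem tensor_op_bilinear: "bilinear_map K T T T (tensor_op K M N f g)"
  unfolding bilinear_map_def tensor_op_def[abs_def]
  by (intro conjI ballI U.lift_linear_param T.module_axioms outer_bilinear U.lift_linear inner_bilinear)

end

theorem tensor_star_pure:
  assumes "bilinear_map K M M M dot\<^sub>1" "bilinear_map K M M M star\<^sub>1"
    and "bilinear_map K N N N dot\<^sub>2" "bilinear_map K N N N star\<^sub>2"
    and "x\<^sub>1 \<in> carrier M" "x\<^sub>2 \<in> carrier N" "y\<^sub>1 \<in> carrier M" "y\<^sub>2 \<in> carrier N"
  shows "tensor_star K M N dot\<^sub>1 star\<^sub>1 dot\<^sub>2 star\<^sub>2 (x\<^sub>1 \<otimes>\<^sub>T x\<^sub>2) (y\<^sub>1 \<otimes>\<^sub>T y\<^sub>2) =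
    (star\<^sub>1 x\<^sub>1 y\<^sub>1 \<otimes>\<^sub>T dot\<^sub>2 x\<^sub>2 y\<^sub>2) \<oplus>\<^bsub>T\<^esub> (dot\<^sub>1 x\<^sub>1 y\<^sub>1 \<otimes>\<^sub>T star\<^sub>2 x\<^sub>2 y\<^sub>2)"
  using assms by (simp add: tensor_star_def tensor_op_pure)

end

end

theory Submission
  imports Defs
begin

text \<open>
  The idea is to replace admissibility by a condition that survives tensor products. Write \<open>\<bullet>\<close> and \<open>\<star>\<close>
  for the two operations. Given a commutative Hom-associative \<open>\<bullet>\<close> and a Hom-Novikov \<open>\<star>\<close>, the algebra is
  an admissible Hom-Novikov-Poisson algebra if and only if \<open>\<star>\<close> may be exchanged with \<open>\<bullet>\<close> in all mixed
  products:
  \<open>(x \<star> y) \<bullet> \<alpha> z = (x \<bullet> y) \<star> \<alpha> z = \<alpha> x \<star> (y \<bullet> z)\<close>.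
  The forward direction (\<open>star_dot_eq_dot_star\<close>, \<open>twist_star_dot_eq_dot_star\<close>) compares the Hom-Leibniz
  identity with the compatibility conditions of a Hom-Novikov-Poisson algebra. The converse
  (\<open>admissible_hom_novikov_poisson_algebraI\<close>) holds because the mixed product is then symmetric in all
  three arguments; the Hom-Jacobi identity comes from the Hom-left-symmetric identity.

  On \<open>A\<^sub>1 \<otimes> A\<^sub>2\<close> let \<open>E\<^sub>i = (x\<^sub>i \<bullet> y\<^sub>i) \<bullet> \<alpha> z\<^sub>i\<close> and \<open>S\<^sub>i = (x\<^sub>i \<bullet> y\<^sub>i) \<star> \<alpha> z\<^sub>i\<close>, which are both totally symmetric.
  On pure tensors each of the three mixed products is \<open>S\<^sub>1 \<otimes> E\<^sub>2 + E\<^sub>1 \<otimes> S\<^sub>2\<close>, so the exchange laws hold.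
  Moreover
  \<open>(x \<star> y) \<star> \<alpha> z = ((x\<^sub>1 \<star> y\<^sub>1) \<star> \<alpha> z\<^sub>1) \<otimes> E\<^sub>2 + 2 (S\<^sub>1 \<otimes> S\<^sub>2) + E\<^sub>1 \<otimes> ((x\<^sub>2 \<star> y\<^sub>2) \<star> \<alpha> z\<^sub>2)\<close>,
  which is symmetric in \<open>y\<close> and \<open>z\<close> because the factors are Hom-Novikov. In \<open>\<alpha> x \<star> (y \<star> z)\<close> the middle
  term is the same, so the Hom-associator is \<open>as\<^sub>1 \<otimes> E\<^sub>2 + E\<^sub>1 \<otimes> as\<^sub>2\<close> (\<open>pure_associator\<close>), which is symmetric
  in \<open>x\<close> and \<open>y\<close>. Every identity has multilinear sides, hence extends from pure tensors to the whole
  tensor product (\<open>tensor_ext3\<close>).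
\<close>

section \<open>Cancellation in abelian groups\<close>

text \<open>
  The twelve terms that remain of the Hom-Jacobi sum after the Hom-left-symmetric identity has been
  applied to its three brackets, with \<open>p = \<alpha> x \<star> (y \<star> z)\<close>, \<open>p' = \<alpha> x \<star> (z \<star> y)\<close>, \<open>q\<close>, \<open>q'\<close> the same
  with \<open>\<alpha> y\<close> and \<open>r\<close>, \<open>r'\<close> the same with \<open>\<alpha> z\<close> in front.
\<close>

lemma (in abelian_group) cyclic_difference_cancel:
  assumes "p \<in> carrier G" "p' \<in> carrier G" "q \<in> carrier G" "q' \<in> carrier G" "r \<in> carrier G" "r' \<in> carrier G"
  shows "((p \<ominus> q) \<ominus> (r \<ominus> r')) \<oplus> ((r \<ominus> p') \<ominus> (q' \<ominus> q)) \<oplus> ((q' \<ominus> r') \<ominus> (p \<ominus> p')) = \<zero>"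
proof -
  have diff: "(a \<ominus> b) \<ominus> (c \<ominus> d) = (a \<oplus> d) \<ominus> (b \<oplus> c)"
    if "a \<in> carrier G" "b \<in> carrier G" "c \<in> carrier G" "d \<in> carrier G" for a b c d
    using that by (simp add: minus_eq minus_add a_ac)
  have sum: "(a \<ominus> b) \<oplus> (c \<ominus> d) = (a \<oplus> c) \<ominus> (b \<oplus> d)"
    if "a \<in> carrier G" "b \<in> carrier G" "c \<in> carrier G" "d \<in> carrier G" for a b c d
    using that by (simp add: minus_eq minus_add a_ac)
  show ?thesis
    using assms by (simp add: diff sum) (simp add: a_ac minus_eq r_neg)
qed

lemma (in abelian_group) minus_exchange:
  assumes "a \<ominus> b = c \<ominus> d"
    and "a \<in> carrier G" "b \<in> carrier G" "c \<in> carrier G" "d \<in> carrier G"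
  shows "a \<ominus> c = b \<ominus> d"
proof -
  have "a \<ominus> c = (a \<ominus> b) \<oplus> (b \<ominus> c)"
    using assms(2-5) by (simp add: minus_eq a_assoc r_neg1)
  also have "\<dots> = (b \<ominus> d) \<oplus> (c \<ominus> c)"
    using assms(2-5) unfolding assms(1) by (simp add: minus_eq a_ac)
  finally show ?thesis
    using assms(2-5) by (simp add: minus_eq r_neg)
qed

lemma (in abelian_group) minus_cancel_middle:
  assumes "a \<in> carrier G" "b \<in> carrier G" "s \<in> carrier G" "c \<in> carrier G" "d \<in> carrier G"
  shows "(a \<oplus> s \<oplus> b) \<ominus> (c \<oplus> s \<oplus> d) = (a \<ominus> c) \<oplus> (b \<ominus> d)"
proof -
  have "(a \<oplus> s \<oplus> b) \<ominus> (c \<oplus> s \<oplus> d) = (a \<ominus> c) \<oplus> (b \<ominus> d) \<oplus> (s \<oplus> \<ominus> s)"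
    using assms by (simp only: minus_eq minus_add a_ac a_closed a_inv_closed)
  then show ?thesis using assms by (simp add: r_neg)
qed

section \<open>Multilinear maps\<close>

lemma linear_map_comp:
  "linear_map K M P f \<Longrightarrow> linear_map K P Q g \<Longrightarrow> linear_map K M Q (\<lambda>x. g (f x))"
  by (auto simp: linear_map_def Pi_iff)

lemma linear_map_add:
  assumes "module K P" "linear_map K M P f" "linear_map K M P g"
  shows "linear_map K M P (\<lambda>x. f x \<oplus>\<^bsub>P\<^esub> g x)"
proof -
  interpret P: module K P by fact
  show ?thesis
    using assms(2,3) by (auto simp: linear_map_def Pi_iff P.M.a_ac P.smult_r_distr)
qed

lemma linear_map_diff:
  assumes "module K P" "linear_map K M P f" "linear_map K M P g"
  shows "linear_map K M P (\<lambda>x. f x \<ominus>\<^bsub>P\<^esub> g x)"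
proof -
  interpret P: module K P by fact
  show ?thesis
    using assms(2,3)
    by (auto simp: linear_map_def Pi_iff P.M.minus_eq P.M.a_ac P.M.minus_add P.smult_r_distr P.smult_r_minus)
qed

lemma bilinear_map_closed:
  "bilinear_map K M N P f \<Longrightarrow> x \<in> carrier M \<Longrightarrow> y \<in> carrier N \<Longrightarrow> f x y \<in> carrier P"
  by (auto simp: bilinear_map_def linear_map_def)

lemma bilinear_map_add:
  assumes "module K P" "bilinear_map K M N P f" "bilinear_map K M N P g"
  shows "bilinear_map K M N P (\<lambda>x y. f x y \<oplus>\<^bsub>P\<^esub> g x y)"
  using assms by (auto simp: bilinear_map_def intro!: linear_map_add)

lemma bilinear_map_commutator:
  assumes "module K P" "bilinear_map K M M P f"
  shows "bilinear_map K M M P (\<lambda>x y. f x y \<ominus>\<^bsub>P\<^esub> f y x)"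
  using assms by (auto simp: bilinear_map_def intro!: linear_map_diff)

lemma linear_map_minus_distr:
  assumes "module K M" "module K P" "linear_map K M P f" "x \<in> carrier M" "y \<in> carrier M"
  shows "f (x \<ominus>\<^bsub>M\<^esub> y) = f x \<ominus>\<^bsub>P\<^esub> f y"
proof -
  interpret M: module K M by fact
  interpret P: module K P by fact
  note L = linear_mapD[OF assms(3)]
  have "f (\<ominus>\<^bsub>M\<^esub> y) = f ((\<ominus>\<^bsub>K\<^esub> \<one>\<^bsub>K\<^esub>) \<odot>\<^bsub>M\<^esub> y)"
    using assms(5) by (simp add: M.smult_l_minus)
  also have "\<dots> = (\<ominus>\<^bsub>K\<^esub> \<one>\<^bsub>K\<^esub>) \<odot>\<^bsub>P\<^esub> f y"
    using assms(5) by (simp add: L(3))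
  also have "\<dots> = \<ominus>\<^bsub>P\<^esub> f y"
    using assms(5) by (simp add: P.smult_l_minus L(1))
  finally show ?thesis
    using assms(4,5) by (simp add: M.M.minus_eq P.M.minus_eq L(2))
qed

definition trilinear_map where
  "trilinear_map K M P f \<longleftrightarrow>
     (\<forall>y\<in>carrier M. \<forall>z\<in>carrier M. linear_map K M P (\<lambda>x. f x y z)) \<and>
     (\<forall>x\<in>carrier M. \<forall>z\<in>carrier M. linear_map K M P (\<lambda>y. f x y z)) \<and>
     (\<forall>x\<in>carrier M. \<forall>y\<in>carrier M. linear_map K M P (\<lambda>z. f x y z))"

lemma trilinear_mapD:
  assumes "trilinear_map K M P f"
  shows "y \<in> carrier M \<Longrightarrow> z \<in> carrier M \<Longrightarrow> linear_map K M P (\<lambda>x. f x y z)"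
    and "x \<in> carrier M \<Longrightarrow> z \<in> carrier M \<Longrightarrow> linear_map K M P (\<lambda>y. f x y z)"
    and "x \<in> carrier M \<Longrightarrow> y \<in> carrier M \<Longrightarrow> linear_map K M P (\<lambda>z. f x y z)"
  using assms by (auto simp: trilinear_map_def)

lemma trilinear_map_swap12: "trilinear_map K M P f \<Longrightarrow> trilinear_map K M P (\<lambda>x y z. f y x z)"
  by (auto simp: trilinear_map_def)

lemma trilinear_map_swap23: "trilinear_map K M P f \<Longrightarrow> trilinear_map K M P (\<lambda>x y z. f x z y)"
  by (auto simp: trilinear_map_def)

lemma trilinear_map_diff:
  assumes "module K P" "trilinear_map K M P f" "trilinear_map K M P g"
  shows "trilinear_map K M P (\<lambda>x y z. f x y z \<ominus>\<^bsub>P\<^esub> g x y z)"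
  using assms by (auto simp: trilinear_map_def intro!: linear_map_diff)

text \<open>
  The two bracketings with a twist, from which both sides of every identity of degree three below are built.
\<close>

lemma trilinear_map_nest:
  assumes b: "bilinear_map K M M M b" and c: "bilinear_map K M M M c" and a: "linear_map K M M a"
  shows "trilinear_map K M M (\<lambda>x y z. b (c x y) (a z))"
    and "trilinear_map K M M (\<lambda>x y z. b (a x) (c y z))"
proof -
  note [intro] = linear_mapD(1)[OF a] bilinear_map_closed[OF c]
  note left = linear_map_comp[where g = "\<lambda>x. b x _", OF _ bilinear_mapD(2)[OF b]]
  note right = linear_map_comp[where g = "b _", OF _ bilinear_mapD(1)[OF b]]
  show "trilinear_map K M M (\<lambda>x y z. b (c x y) (a z))"
    unfolding trilinear_map_def
    by (intro conjI ballI; (rule left right[OF a])?) (auto intro: bilinear_mapD[OF c])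
  show "trilinear_map K M M (\<lambda>x y z. b (a x) (c y z))"
    unfolding trilinear_map_def
    by (intro conjI ballI; (rule right[OF bilinear_mapD(1)[OF c]] right[OF bilinear_mapD(2)[OF c]] left[OF a])?) auto
qed

section \<open>Multilinear maps are determined by pure tensors\<close>

context tensor
begin

lemma free_module_induct [consumes 1, case_names zero add smult gen]:
  assumes "u \<in> carrier F"
    and zero: "Q \<zero>\<^bsub>F\<^esub>"
    and add: "\<And>u v. u \<in> carrier F \<Longrightarrow> v \<in> carrier F \<Longrightarrow> Q u \<Longrightarrow> Q v \<Longrightarrow> Q (u \<oplus>\<^bsub>F\<^esub> v)"
    and smult: "\<And>a u. a \<in> carrier K \<Longrightarrow> u \<in> carrier F \<Longrightarrow> Q u \<Longrightarrow> Q (a \<odot>\<^bsub>F\<^esub> u)"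
    and gen: "\<And>x y. x \<in> carrier M \<Longrightarrow> y \<in> carrier N \<Longrightarrow> Q (free_gen K (x, y))"
  shows "Q u"
proof -
  have "Q v" if "finite A" "A \<subseteq> carrier M \<times> carrier N" "v \<in> UNIV \<rightarrow> carrier K" "{s. v s \<noteq> \<zero>\<^bsub>K\<^esub>} \<subseteq> A" for A v
    using that
  proof (induction A arbitrary: v rule: finite_induct)
    case empty
    then have "v = \<zero>\<^bsub>F\<^esub>" by auto
    then show ?case using zero by simp
  next
    case (insert s A)
    \<comment> \<open>Split off the summand at \<open>s\<close>; what remains is supported in \<open>A\<close>.\<close>
    define w where "w = v(s := \<zero>\<^bsub>K\<^esub>)"
    have wA: "{t. w t \<noteq> \<zero>\<^bsub>K\<^esub>} \<subseteq> A" and wK: "w \<in> UNIV \<rightarrow> carrier K"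
      using insert.prems by (auto simp: w_def)
    have w: "Q w" using insert.prems(1) wA wK by (intro insert.IH) auto
    have wF: "w \<in> carrier F"
      using insert.prems(1) insert.hyps(1) wA wK by (intro free_module_memI[where A = A]) auto
    obtain x y where s: "s = (x, y)" "x \<in> carrier M" "y \<in> carrier N"
      using insert.prems(1) by auto
    have vs: "v s \<in> carrier K" using insert.prems(2) by auto
    have "v = w \<oplus>\<^bsub>F\<^esub> (v s \<odot>\<^bsub>F\<^esub> free_gen K s)"
      using insert.prems(2) vs by (auto simp: w_def free_gen_def Pi_iff)
    moreover have "Q (w \<oplus>\<^bsub>F\<^esub> (v s \<odot>\<^bsub>F\<^esub> free_gen K s))"
      unfolding s(1)
      by (intro add smult gen w wF F.smult_closed gen_closed s vs[unfolded s(1)])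
    ultimately show ?case by simp
  qed
  from this[of "{s. u s \<noteq> \<zero>\<^bsub>K\<^esub>}" u] show ?thesis using assms(1) by auto
qed

text \<open>
  The pure tensors span \<open>T\<close>, because they are the cosets of the generators of \<open>F\<close>.
\<close>

lemma tensor_induct [consumes 1, case_names zero add smult pure]:
  assumes "X \<in> carrier T"
    and "Q \<zero>\<^bsub>T\<^esub>"
    and add: "\<And>X Y. X \<in> carrier T \<Longrightarrow> Y \<in> carrier T \<Longrightarrow> Q X \<Longrightarrow> Q Y \<Longrightarrow> Q (X \<oplus>\<^bsub>T\<^esub> Y)"
    and smult: "\<And>a X. a \<in> carrier K \<Longrightarrow> X \<in> carrier T \<Longrightarrow> Q X \<Longrightarrow> Q (a \<odot>\<^bsub>T\<^esub> X)"
    and pure: "\<And>x y. x \<in> carrier M \<Longrightarrow> y \<in> carrier N \<Longrightarrow> Q (x \<otimes>\<^sub>T y)"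
  shows "Q X"
proof -
  note [simp del] = free_module_sel
  obtain u where u: "u \<in> carrier F" "X = tensor_kernel K M N +>\<^bsub>F\<^esub> u"
    using assms(1) unfolding carrier_T by blast
  have coset: "tensor_kernel K M N +>\<^bsub>F\<^esub> v \<in> carrier T" if "v \<in> carrier F" for v
    using that unfolding carrier_T by blast
  have "Q (tensor_kernel K M N +>\<^bsub>F\<^esub> u)"
    using u(1)
  proof (induction rule: free_module_induct)
    case zero
    have "tensor_kernel K M N +>\<^bsub>F\<^esub> \<zero>\<^bsub>F\<^esub> = \<zero>\<^bsub>T\<^esub>"
      using ker.a_subset by (simp add: tensor_product_def quotient_module_def)
    then show ?case using assms(2) by simp
  next
    case (add u v)
    then show ?case by (metis add_T coset assms(3))
  next
    case (smult a u)
    then show ?case by (metis smult_T coset assms(4))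
  next
    case (gen x y)
    then show ?case using pure by (simp add: pure_tensor_def)
  qed
  then show ?thesis by (simp add: u(2))
qed

lemma tensor_ext:
  assumes "module K P" and f: "linear_map K T P f" and g: "linear_map K T P g"
    and pure: "\<And>x y. x \<in> carrier M \<Longrightarrow> y \<in> carrier N \<Longrightarrow> f (x \<otimes>\<^sub>T y) = g (x \<otimes>\<^sub>T y)"
    and "X \<in> carrier T"
  shows "f X = g X"
  using assms(5)
proof (induction rule: tensor_induct)
  case zero
  interpret P: module K P by fact
  have zero: "h \<zero>\<^bsub>T\<^esub> = \<zero>\<^bsub>P\<^esub>" if "linear_map K T P h" for h
    using linear_mapD(1,3)[OF that]
    by (metis M.R.zero_closed P.smult_l_null T.M.zero_closed T.smult_l_null)
  show ?case by (simp only: zero[OF f] zero[OF g])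
qed (simp_all add: linear_mapD[OF f] linear_mapD[OF g] pure)

text \<open>
  One argument is reduced to a pure tensor at a time, the others being held fixed.
\<close>

lemma tensor_ext2:
  assumes "module K P" and f: "bilinear_map K T T P f" and g: "bilinear_map K T T P g"
    and pure: "\<And>x x' y y'. \<lbrakk>x \<in> carrier M; x' \<in> carrier N; y \<in> carrier M; y' \<in> carrier N\<rbrakk> \<Longrightarrow>
      f (x \<otimes>\<^sub>T x') (y \<otimes>\<^sub>T y') = g (x \<otimes>\<^sub>T x') (y \<otimes>\<^sub>T y')"
    and XY: "X \<in> carrier T" "Y \<in> carrier T"
  shows "f X Y = g X Y"
proof (rule tensor_ext[OF assms(1) bilinear_mapD(2)[OF f] bilinear_mapD(2)[OF g]])
  fix x x' assume x: "x \<in> carrier M" "x' \<in> carrier N"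
  show "f (x \<otimes>\<^sub>T x') Y = g (x \<otimes>\<^sub>T x') Y"
    by (rule tensor_ext[OF assms(1) bilinear_mapD(1)[OF f] bilinear_mapD(1)[OF g]])
      (use x XY pure in auto)
qed (use XY in auto)

lemma tensor_ext3:
  assumes "module K P" and f: "trilinear_map K T P f" and g: "trilinear_map K T P g"
    and pure: "\<And>x x' y y' z z'.
      \<lbrakk>x \<in> carrier M; x' \<in> carrier N; y \<in> carrier M; y' \<in> carrier N; z \<in> carrier M; z' \<in> carrier N\<rbrakk> \<Longrightarrow>
      f (x \<otimes>\<^sub>T x') (y \<otimes>\<^sub>T y') (z \<otimes>\<^sub>T z') = g (x \<otimes>\<^sub>T x') (y \<otimes>\<^sub>T y') (z \<otimes>\<^sub>T z')"
    and XYZ: "X \<in> carrier T" "Y \<in> carrier T" "Z \<in> carrier T"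
  shows "f X Y Z = g X Y Z"
proof (rule tensor_ext[OF assms(1) trilinear_mapD(1)[OF f] trilinear_mapD(1)[OF g]])
  fix x x' assume x: "x \<in> carrier M" "x' \<in> carrier N"
  have slice: "bilinear_map K T T P (h (x \<otimes>\<^sub>T x'))" if "trilinear_map K T P h" for h
    using trilinear_mapD(2,3)[OF that] x by (simp add: bilinear_map_def)
  show "f (x \<otimes>\<^sub>T x') Y Z = g (x \<otimes>\<^sub>T x') Y Z"
    by (rule tensor_ext2[OF assms(1) slice[OF f] slice[OF g]]) (use x XYZ pure in auto)
qed (use XYZ in auto)

end

section \<open>The commutator of a Hom-Novikov algebra\<close>

context hom_novikov_algebra
begin

lemma star_closed: "x \<in> carrier A \<Longrightarrow> y \<in> carrier A \<Longrightarrow> x \<star> y \<in> carrier A"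
  by (rule bilinear_map_closed[OF bilinear])

lemma twist_closed: "x \<in> carrier A \<Longrightarrow> \<alpha> x \<in> carrier A"
  by (rule linear_mapD(1)[OF twist_linear])

lemma star_diff:
  assumes "x \<in> carrier A" "y \<in> carrier A" "z \<in> carrier A"
  shows "(x \<ominus>\<^bsub>A\<^esub> y) \<star> z = (x \<star> z) \<ominus>\<^bsub>A\<^esub> (y \<star> z)" "z \<star> (x \<ominus>\<^bsub>A\<^esub> y) = (z \<star> x) \<ominus>\<^bsub>A\<^esub> (z \<star> y)"
  using assms
  by (simp_all add: linear_map_minus_distr[OF module_axioms module_axioms bilinear_mapD(1)[OF bilinear]]
      linear_map_minus_distr[OF module_axioms module_axioms bilinear_mapD(2)[OF bilinear]])

text \<open>
  The Hom-left-symmetric identity replaces the difference \<open>(u \<star> v) \<star> \<alpha> w - (v \<star> u) \<star> \<alpha> w\<close> in the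
  Hom-Jacobi sum by \<open>\<alpha> u \<star> (v \<star> w) - \<alpha> v \<star> (u \<star> w)\<close>. After that every product in the sum occurs twice,
  with opposite signs.
\<close>

lemma commutator_hom_lie: "hom_lie_algebra K A (\<lambda>x y. (x \<star> y) \<ominus>\<^bsub>A\<^esub> (y \<star> x)) \<alpha>"
proof
  show "bilinear_map K A A A (\<lambda>x y. (x \<star> y) \<ominus>\<^bsub>A\<^esub> (y \<star> x))"
    by (rule bilinear_map_commutator[OF module_axioms bilinear])
next
  fix x y assume "x \<in> carrier A" "y \<in> carrier A"
  then show "(x \<star> y) \<ominus>\<^bsub>A\<^esub> (y \<star> x) = \<ominus>\<^bsub>A\<^esub> ((y \<star> x) \<ominus>\<^bsub>A\<^esub> (x \<star> y))"
    by (simp add: star_closed M.minus_eq M.minus_add M.a_ac)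
next
  fix x y z assume xyz: "x \<in> carrier A" "y \<in> carrier A" "z \<in> carrier A"
  have bracket: "(((u \<star> v) \<ominus>\<^bsub>A\<^esub> (v \<star> u)) \<star> \<alpha> w) \<ominus>\<^bsub>A\<^esub> (\<alpha> w \<star> ((u \<star> v) \<ominus>\<^bsub>A\<^esub> (v \<star> u))) =
      ((\<alpha> u \<star> (v \<star> w)) \<ominus>\<^bsub>A\<^esub> (\<alpha> v \<star> (u \<star> w))) \<ominus>\<^bsub>A\<^esub> ((\<alpha> w \<star> (u \<star> v)) \<ominus>\<^bsub>A\<^esub> (\<alpha> w \<star> (v \<star> u)))"
    if "u \<in> carrier A" "v \<in> carrier A" "w \<in> carrier A" for u v w
    using M.minus_exchange[OF hom_left_symmetric[of u v w]] that
    by (simp add: star_diff star_closed twist_closed)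
  show "((((x \<star> y) \<ominus>\<^bsub>A\<^esub> (y \<star> x)) \<star> \<alpha> z) \<ominus>\<^bsub>A\<^esub> (\<alpha> z \<star> ((x \<star> y) \<ominus>\<^bsub>A\<^esub> (y \<star> x)))) \<oplus>\<^bsub>A\<^esub>
        ((((z \<star> x) \<ominus>\<^bsub>A\<^esub> (x \<star> z)) \<star> \<alpha> y) \<ominus>\<^bsub>A\<^esub> (\<alpha> y \<star> ((z \<star> x) \<ominus>\<^bsub>A\<^esub> (x \<star> z)))) \<oplus>\<^bsub>A\<^esub>
        ((((y \<star> z) \<ominus>\<^bsub>A\<^esub> (z \<star> y)) \<star> \<alpha> x) \<ominus>\<^bsub>A\<^esub> (\<alpha> x \<star> ((y \<star> z) \<ominus>\<^bsub>A\<^esub> (z \<star> y)))) = \<zero>\<^bsub>A\<^esub>"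
    unfolding bracket[OF xyz] bracket[OF xyz(3,1,2)] bracket[OF xyz(2,3,1)]
    by (rule M.cyclic_difference_cancel) (simp_all add: xyz star_closed twist_closed)
qed (simp_all add: char_0 twist_linear)

end

section \<open>Admissibility as an exchange law\<close>

context admissible_hom_novikov_poisson_algebra
begin

lemma dot_closed: "x \<in> carrier A \<Longrightarrow> y \<in> carrier A \<Longrightarrow> x \<bullet> y \<in> carrier A"
  by (rule bilinear_map_closed[OF bilinear])

lemma dot_diff_left:
  "x \<in> carrier A \<Longrightarrow> y \<in> carrier A \<Longrightarrow> z \<in> carrier A \<Longrightarrow> (x \<ominus>\<^bsub>A\<^esub> y) \<bullet> z = (x \<bullet> z) \<ominus>\<^bsub>A\<^esub> (y \<bullet> z)"
  by (rule linear_map_minus_distr[OF module_axioms module_axioms bilinear_mapD(2)[OF bilinear]])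

lemma dot_diff_right:
  "x \<in> carrier A \<Longrightarrow> y \<in> carrier A \<Longrightarrow> z \<in> carrier A \<Longrightarrow> z \<bullet> (x \<ominus>\<^bsub>A\<^esub> y) = (z \<bullet> x) \<ominus>\<^bsub>A\<^esub> (z \<bullet> y)"
  by (rule linear_map_minus_distr[OF module_axioms module_axioms bilinear_mapD(1)[OF bilinear]])

text \<open>
  This is the Hom-Leibniz identity of the commutator: \<open>(y \<bullet> z) \<star> \<alpha> x = (y \<star> x) \<bullet> \<alpha> z\<close> occurs on
  both of its sides and cancels.
\<close>

lemma leibniz_expanded:
  assumes xyz: "x \<in> carrier A" "y \<in> carrier A" "z \<in> carrier A"
  shows "\<alpha> x \<star> (y \<bullet> z) = ((x \<star> y) \<bullet> \<alpha> z) \<oplus>\<^bsub>A\<^esub> (((x \<star> z) \<bullet> \<alpha> y) \<ominus>\<^bsub>A\<^esub> ((z \<star> x) \<bullet> \<alpha> y))"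
proof -
  note c = xyz dot_closed Nov.star_closed Nov.twist_closed
  have "(\<alpha> x \<star> (y \<bullet> z)) \<ominus>\<^bsub>A\<^esub> ((y \<bullet> z) \<star> \<alpha> x) =
      (((x \<star> y) \<ominus>\<^bsub>A\<^esub> (y \<star> x)) \<bullet> \<alpha> z) \<oplus>\<^bsub>A\<^esub> (\<alpha> y \<bullet> ((x \<star> z) \<ominus>\<^bsub>A\<^esub> (z \<star> x)))"
    by (rule hom_poisson_algebra.hom_leibniz[OF admissible xyz])
  also have "\<dots> = (((x \<star> y) \<bullet> \<alpha> z) \<ominus>\<^bsub>A\<^esub> ((y \<star> x) \<bullet> \<alpha> z)) \<oplus>\<^bsub>A\<^esub>
      (((x \<star> z) \<bullet> \<alpha> y) \<ominus>\<^bsub>A\<^esub> ((z \<star> x) \<bullet> \<alpha> y))"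
    by (simp add: c dot_diff_left dot_diff_right commutative[of "\<alpha> y"])
  finally have "(\<alpha> x \<star> (y \<bullet> z)) \<ominus>\<^bsub>A\<^esub> ((y \<star> x) \<bullet> \<alpha> z) = \<dots>"
    by (simp add: c dot_star_compatible)
  also have "\<dots> = (((x \<star> y) \<bullet> \<alpha> z) \<oplus>\<^bsub>A\<^esub> (((x \<star> z) \<bullet> \<alpha> y) \<ominus>\<^bsub>A\<^esub> ((z \<star> x) \<bullet> \<alpha> y))) \<ominus>\<^bsub>A\<^esub>
      ((y \<star> x) \<bullet> \<alpha> z)"
    by (simp add: c M.minus_eq M.a_ac)
  finally show ?thesis
    by (simp add: c M.minus_eq)
qed

text \<open>
  Substituting \<open>leibniz_expanded\<close> into both sides of \<open>star_dot_compatible\<close> leaves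
  \<open>(z \<star> x) \<bullet> \<alpha> y - (x \<star> z) \<bullet> \<alpha> y\<close>, which is therefore symmetric in \<open>x\<close> and \<open>y\<close>; its subtrahend equals
  \<open>(x \<bullet> y) \<star> \<alpha> z\<close> and is so too.
\<close>

lemma star_dot_swap_right:
  assumes xyz: "x \<in> carrier A" "y \<in> carrier A" "z \<in> carrier A"
  shows "(z \<star> x) \<bullet> \<alpha> y = (z \<star> y) \<bullet> \<alpha> x"
proof -
  note c = xyz dot_closed Nov.star_closed Nov.twist_closed
  have cancel: "a \<ominus>\<^bsub>A\<^esub> (a \<oplus>\<^bsub>A\<^esub> (r \<ominus>\<^bsub>A\<^esub> w)) = w \<ominus>\<^bsub>A\<^esub> r"
    if "a \<in> carrier A" "r \<in> carrier A" "w \<in> carrier A" for a r w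
    using that by (simp add: M.minus_eq M.minus_add M.r_neg2 M.a_comm[of "\<ominus>\<^bsub>A\<^esub> r"])
  have "(x \<star> z) \<bullet> \<alpha> y = (y \<star> z) \<bullet> \<alpha> x"
    using dot_star_compatible[of x y z] dot_star_compatible[of y x z] by (simp add: c commutative)
  moreover have "((z \<star> x) \<bullet> \<alpha> y) \<ominus>\<^bsub>A\<^esub> ((x \<star> z) \<bullet> \<alpha> y) = ((z \<star> y) \<bullet> \<alpha> x) \<ominus>\<^bsub>A\<^esub> ((y \<star> z) \<bullet> \<alpha> x)"
    using star_dot_compatible[OF xyz] by (simp add: leibniz_expanded cancel c)
  ultimately show ?thesis
    by (simp add: c M.minus_eq)
qed

lemma star_dot_eq_dot_star:
  assumes xyz: "x \<in> carrier A" "y \<in> carrier A" "z \<in> carrier A"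
  shows "(x \<star> y) \<bullet> \<alpha> z = (x \<bullet> y) \<star> \<alpha> z"
  using star_dot_swap_right[of y z x] dot_star_compatible[of x y z] xyz by simp

text \<open>
  The exchange law just proved makes \<open>(x \<star> z) \<bullet> \<alpha> y\<close> symmetric in \<open>x\<close> and \<open>z\<close>, so that the difference in
  \<open>leibniz_expanded\<close> vanishes.
\<close>

lemma twist_star_dot_eq_dot_star:
  assumes xyz: "x \<in> carrier A" "y \<in> carrier A" "z \<in> carrier A"
  shows "\<alpha> x \<star> (y \<bullet> z) = (x \<bullet> y) \<star> \<alpha> z"
proof -
  note c = xyz dot_closed Nov.star_closed Nov.twist_closed
  have "(x \<star> z) \<bullet> \<alpha> y = (z \<star> x) \<bullet> \<alpha> y"
    using star_dot_eq_dot_star[of x z y] star_dot_eq_dot_star[of z x y] commutative[of x z] xyz by simp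
  then have "\<alpha> x \<star> (y \<bullet> z) = (x \<star> y) \<bullet> \<alpha> z"
    by (simp add: leibniz_expanded c M.minus_eq M.r_neg)
  then show ?thesis by (simp add: star_dot_eq_dot_star c)
qed

lemma dot_star_perm:
  assumes xyz: "x \<in> carrier A" "y \<in> carrier A" "z \<in> carrier A"
  shows "(x \<bullet> z) \<star> \<alpha> y = (x \<bullet> y) \<star> \<alpha> z"
  using star_dot_swap_right[of y z x] xyz by (simp add: star_dot_eq_dot_star)

lemma dot_perm:
  assumes xyz: "x \<in> carrier A" "y \<in> carrier A" "z \<in> carrier A"
  shows "(x \<bullet> z) \<bullet> \<alpha> y = (x \<bullet> y) \<bullet> \<alpha> z"
  using xyz by (simp add: hom_associative commutative[of z])

end

text \<open>
  By the two exchange laws \<open>(x \<bullet> y) \<star> \<alpha> z\<close> is symmetric in \<open>x, y\<close> (as \<open>\<bullet>\<close> is commutative) and in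
  \<open>y, z\<close> (being \<open>\<alpha> x \<star> (y \<bullet> z)\<close>), hence totally symmetric. Every term in the compatibility conditions is
  such a product, and each of the three terms of the Hom-Leibniz identity is a difference of two
  equal ones. This form of
  admissibility has no differences in it, which makes it easy to verify on pure tensors.
\<close>

theorem admissible_hom_novikov_poisson_algebraI:
  fixes K (structure) and A (structure) and dot (infixl \<open>\<bullet>\<close> 70) and star (infixl \<open>\<star>\<close> 70)
  assumes "comm_hom_associative_algebra K A dot \<alpha>" "hom_novikov_algebra K A star \<alpha>"
    and star_dot: "\<And>x y z. \<lbrakk>x \<in> carrier A; y \<in> carrier A; z \<in> carrier A\<rbrakk> \<Longrightarrow>
      (x \<star> y) \<bullet> \<alpha> z = (x \<bullet> y) \<star> \<alpha> z"
    and twist_star_dot: "\<And>x y z. \<lbrakk>x \<in> carrier A; y \<in> carrier A; z \<in> carrier A\<rbrakk> \<Longrightarrow>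
      \<alpha> x \<star> (y \<bullet> z) = (x \<bullet> y) \<star> \<alpha> z"
  shows "admissible_hom_novikov_poisson_algebra K A dot star \<alpha>"
proof -
  interpret D: comm_hom_associative_algebra K A dot \<alpha> by fact
  interpret S: hom_novikov_algebra K A star \<alpha> by fact
  interpret L: hom_lie_algebra K A "\<lambda>x y. (x \<star> y) \<ominus>\<^bsub>A\<^esub> (y \<star> x)" \<alpha>
    by (rule S.commutator_hom_lie)
  note c = bilinear_map_closed[OF D.bilinear] S.star_closed S.twist_closed
  have comm12: "(x \<bullet> y) \<star> \<alpha> z = (y \<bullet> x) \<star> \<alpha> z"
    if "x \<in> carrier A" "y \<in> carrier A" "z \<in> carrier A" for x y z
    using that by (simp add: D.commutative)
  have comm23: "(x \<bullet> z) \<star> \<alpha> y = (x \<bullet> y) \<star> \<alpha> z"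
    if "x \<in> carrier A" "y \<in> carrier A" "z \<in> carrier A" for x y z
    using that twist_star_dot[of x y z] twist_star_dot[of x z y] by (simp add: D.commutative[of z y])
  show ?thesis
  proof
    fix x y z assume xyz: "x \<in> carrier A" "y \<in> carrier A" "z \<in> carrier A"
    show "((x \<star> y) \<bullet> \<alpha> z) \<ominus>\<^bsub>A\<^esub> (\<alpha> x \<star> (y \<bullet> z)) = ((y \<star> x) \<bullet> \<alpha> z) \<ominus>\<^bsub>A\<^esub> (\<alpha> y \<star> (x \<bullet> z))"
      using xyz by (simp add: star_dot twist_star_dot D.commutative[of y x])
    show "(x \<bullet> y) \<star> \<alpha> z = (x \<star> z) \<bullet> \<alpha> y"
      using xyz by (simp add: star_dot comm23)
    have "(\<alpha> x \<star> (y \<bullet> z)) \<ominus>\<^bsub>A\<^esub> ((y \<bullet> z) \<star> \<alpha> x) = \<zero>\<^bsub>A\<^esub>"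
    proof -
      have "(y \<bullet> z) \<star> \<alpha> x = (x \<bullet> y) \<star> \<alpha> z"
        using comm23[of y x z] comm12[of x y z] xyz by simp
      then show ?thesis
        using xyz by (simp add: twist_star_dot c D.M.minus_eq D.M.r_neg)
    qed
    moreover have bracket: "((u \<star> v) \<ominus>\<^bsub>A\<^esub> (v \<star> u)) \<bullet> \<alpha> w = \<zero>\<^bsub>A\<^esub>"
      if "u \<in> carrier A" "v \<in> carrier A" "w \<in> carrier A" for u v w
      using that D.commutative[of v u] linear_map_minus_distr[OF D.module_axioms D.module_axioms bilinear_mapD(2)[OF D.bilinear]]
      by (simp add: c star_dot D.M.minus_eq D.M.r_neg)
    ultimately show "(\<alpha> x \<star> (y \<bullet> z)) \<ominus>\<^bsub>A\<^esub> ((y \<bullet> z) \<star> \<alpha> x) =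
        (((x \<star> y) \<ominus>\<^bsub>A\<^esub> (y \<star> x)) \<bullet> \<alpha> z) \<oplus>\<^bsub>A\<^esub> (\<alpha> y \<bullet> ((x \<star> z) \<ominus>\<^bsub>A\<^esub> (z \<star> x)))"
      using xyz by (simp add: c D.commutative[of "\<alpha> y"])
  qed
qed

section \<open>The tensor product of two admissible algebras\<close>

locale admissible_pair =
  A\<^sub>1: admissible_hom_novikov_poisson_algebra K M dot\<^sub>1 star\<^sub>1 \<alpha>\<^sub>1 +
  A\<^sub>2: admissible_hom_novikov_poisson_algebra K N dot\<^sub>2 star\<^sub>2 \<alpha>\<^sub>2
  for K (structure) and M (structure) and N (structure)
    and dot\<^sub>1 (infixl \<open>\<bullet>\<^sub>1\<close> 80) and star\<^sub>1 (infixl \<open>\<star>\<^sub>1\<close> 80) and \<alpha>\<^sub>1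
    and dot\<^sub>2 (infixl \<open>\<bullet>\<^sub>2\<close> 80) and star\<^sub>2 (infixl \<open>\<star>\<^sub>2\<close> 80) and \<alpha>\<^sub>2
begin

sublocale tensor K M N ..

abbreviation dot_T (infixl \<open>\<bullet>\<close> 70) where "X \<bullet> Y \<equiv> tensor_op K M N dot\<^sub>1 dot\<^sub>2 X Y"
abbreviation star_T (infixl \<open>\<star>\<close> 70) where "X \<star> Y \<equiv> tensor_star K M N dot\<^sub>1 star\<^sub>1 dot\<^sub>2 star\<^sub>2 X Y"
abbreviation "\<alpha> \<equiv> tensor_map K M N \<alpha>\<^sub>1 \<alpha>\<^sub>2"

lemmas closed =
  A\<^sub>1.dot_closed A\<^sub>1.Nov.star_closed A\<^sub>1.Nov.twist_closed
  A\<^sub>2.dot_closed A\<^sub>2.Nov.star_closed A\<^sub>2.Nov.twist_closed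

lemma dot_bilinear: "bilinear_map K T T T (\<bullet>)"
  by (rule tensor_op_bilinear[OF A\<^sub>1.bilinear A\<^sub>2.bilinear])

lemma star_bilinear: "bilinear_map K T T T (\<star>)"
  unfolding tensor_star_def[abs_def]
  by (intro bilinear_map_add T.module_axioms tensor_op_bilinear A\<^sub>1.bilinear A\<^sub>2.bilinear
      A\<^sub>1.Nov.bilinear A\<^sub>2.Nov.bilinear)

lemma twist_linear: "linear_map K T T \<alpha>"
  by (rule tensor_map_linear[OF A\<^sub>1.twist_linear A\<^sub>2.twist_linear])

lemmas twist_pure = tensor_map_pure[OF A\<^sub>1.twist_linear A\<^sub>2.twist_linear]
lemmas dot_pure = tensor_op_pure[OF A\<^sub>1.bilinear A\<^sub>2.bilinear]
lemmas star_pure = tensor_star_pure[OF A\<^sub>1.bilinear A\<^sub>1.Nov.bilinear A\<^sub>2.bilinear A\<^sub>2.Nov.bilinear]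

lemmas sum_distrib =
  linear_mapD(2)[OF bilinear_mapD(1)[OF dot_bilinear]] linear_mapD(2)[OF bilinear_mapD(2)[OF dot_bilinear]]
  linear_mapD(2)[OF bilinear_mapD(1)[OF star_bilinear]] linear_mapD(2)[OF bilinear_mapD(2)[OF star_bilinear]]

lemma pure_diff:
  assumes "x \<in> carrier M" "y \<in> carrier M" "x' \<in> carrier N" "y' \<in> carrier N"
  shows "(x \<ominus>\<^bsub>M\<^esub> y) \<otimes>\<^sub>T x' = (x \<otimes>\<^sub>T x') \<ominus>\<^bsub>T\<^esub> (y \<otimes>\<^sub>T x')"
    and "x \<otimes>\<^sub>T (x' \<ominus>\<^bsub>N\<^esub> y') = (x \<otimes>\<^sub>T x') \<ominus>\<^bsub>T\<^esub> (x \<otimes>\<^sub>T y')"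
  using assms
  by (simp_all add: linear_map_minus_distr[OF A\<^sub>1.module_axioms T.module_axioms bilinear_mapD(2)[OF bilinear_pure_tensor]]
      linear_map_minus_distr[OF A\<^sub>2.module_axioms T.module_axioms bilinear_mapD(1)[OF bilinear_pure_tensor]])

lemmas star_dot_shift =
  A\<^sub>1.star_dot_eq_dot_star A\<^sub>1.twist_star_dot_eq_dot_star A\<^sub>2.star_dot_eq_dot_star A\<^sub>2.twist_star_dot_eq_dot_star

context
  fixes x y z x' y' z'
  assumes carr: "x \<in> carrier M" "y \<in> carrier M" "z \<in> carrier M" "x' \<in> carrier N" "y' \<in> carrier N" "z' \<in> carrier N"
begin

text \<open>
  Of the four summands, the two in which each factor carries one \<open>\<star>\<close> and one \<open>\<bullet>\<close> become equal by the
  exchange laws. The other two are a Hom-Novikov product in one factor and a Hom-associative one in the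
  other.
\<close>

lemma pure_star_star_twist:
  "((x \<otimes>\<^sub>T x') \<star> (y \<otimes>\<^sub>T y')) \<star> \<alpha> (z \<otimes>\<^sub>T z') =
    (((x \<star>\<^sub>1 y) \<star>\<^sub>1 \<alpha>\<^sub>1 z) \<otimes>\<^sub>T ((x' \<bullet>\<^sub>2 y') \<bullet>\<^sub>2 \<alpha>\<^sub>2 z')) \<oplus>\<^bsub>T\<^esub>
    ((((x \<bullet>\<^sub>1 y) \<star>\<^sub>1 \<alpha>\<^sub>1 z) \<otimes>\<^sub>T ((x' \<bullet>\<^sub>2 y') \<star>\<^sub>2 \<alpha>\<^sub>2 z')) \<oplus>\<^bsub>T\<^esub>
     (((x \<bullet>\<^sub>1 y) \<star>\<^sub>1 \<alpha>\<^sub>1 z) \<otimes>\<^sub>T ((x' \<bullet>\<^sub>2 y') \<star>\<^sub>2 \<alpha>\<^sub>2 z'))) \<oplus>\<^bsub>T\<^esub>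
    (((x \<bullet>\<^sub>1 y) \<bullet>\<^sub>1 \<alpha>\<^sub>1 z) \<otimes>\<^sub>T ((x' \<star>\<^sub>2 y') \<star>\<^sub>2 \<alpha>\<^sub>2 z'))"
  using carr by (simp add: closed star_pure twist_pure sum_distrib star_dot_shift T.M.a_assoc)

text \<open>
  The mixed summands are the same as in \<open>pure_star_star_twist\<close>, so that they cancel in the Hom-associator.
\<close>

lemma pure_twist_star_star:
  "\<alpha> (x \<otimes>\<^sub>T x') \<star> ((y \<otimes>\<^sub>T y') \<star> (z \<otimes>\<^sub>T z')) =
    ((\<alpha>\<^sub>1 x \<star>\<^sub>1 (y \<star>\<^sub>1 z)) \<otimes>\<^sub>T ((x' \<bullet>\<^sub>2 y') \<bullet>\<^sub>2 \<alpha>\<^sub>2 z')) \<oplus>\<^bsub>T\<^esub>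
    ((((x \<bullet>\<^sub>1 y) \<star>\<^sub>1 \<alpha>\<^sub>1 z) \<otimes>\<^sub>T ((x' \<bullet>\<^sub>2 y') \<star>\<^sub>2 \<alpha>\<^sub>2 z')) \<oplus>\<^bsub>T\<^esub>
     (((x \<bullet>\<^sub>1 y) \<star>\<^sub>1 \<alpha>\<^sub>1 z) \<otimes>\<^sub>T ((x' \<bullet>\<^sub>2 y') \<star>\<^sub>2 \<alpha>\<^sub>2 z'))) \<oplus>\<^bsub>T\<^esub>
    (((x \<bullet>\<^sub>1 y) \<bullet>\<^sub>1 \<alpha>\<^sub>1 z) \<otimes>\<^sub>T (\<alpha>\<^sub>2 x' \<star>\<^sub>2 (y' \<star>\<^sub>2 z')))"
proof -
  have "\<alpha>\<^sub>1 x \<bullet>\<^sub>1 (y \<star>\<^sub>1 z) = (x \<bullet>\<^sub>1 y) \<star>\<^sub>1 \<alpha>\<^sub>1 z"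
    using carr A\<^sub>1.commutative[of "\<alpha>\<^sub>1 x" "y \<star>\<^sub>1 z"] A\<^sub>1.dot_star_perm[of y z x] A\<^sub>1.commutative[of x y]
    by (simp add: closed star_dot_shift)
  moreover have "\<alpha>\<^sub>2 x' \<bullet>\<^sub>2 (y' \<star>\<^sub>2 z') = (x' \<bullet>\<^sub>2 y') \<star>\<^sub>2 \<alpha>\<^sub>2 z'"
    using carr A\<^sub>2.commutative[of "\<alpha>\<^sub>2 x'" "y' \<star>\<^sub>2 z'"] A\<^sub>2.dot_star_perm[of y' z' x'] A\<^sub>2.commutative[of x' y']
    by (simp add: closed star_dot_shift)
  ultimately show ?thesis
    using carr
    by (simp add: closed star_pure twist_pure sum_distrib star_dot_shift A\<^sub>1.hom_associative[symmetric]
        A\<^sub>2.hom_associative[symmetric] T.M.a_assoc)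
qed

lemma pure_associator:
  "(((x \<otimes>\<^sub>T x') \<star> (y \<otimes>\<^sub>T y')) \<star> \<alpha> (z \<otimes>\<^sub>T z')) \<ominus>\<^bsub>T\<^esub> (\<alpha> (x \<otimes>\<^sub>T x') \<star> ((y \<otimes>\<^sub>T y') \<star> (z \<otimes>\<^sub>T z'))) =
    ((((x \<star>\<^sub>1 y) \<star>\<^sub>1 \<alpha>\<^sub>1 z) \<ominus>\<^bsub>M\<^esub> (\<alpha>\<^sub>1 x \<star>\<^sub>1 (y \<star>\<^sub>1 z))) \<otimes>\<^sub>T ((x' \<bullet>\<^sub>2 y') \<bullet>\<^sub>2 \<alpha>\<^sub>2 z')) \<oplus>\<^bsub>T\<^esub>
    (((x \<bullet>\<^sub>1 y) \<bullet>\<^sub>1 \<alpha>\<^sub>1 z) \<otimes>\<^sub>T (((x' \<star>\<^sub>2 y') \<star>\<^sub>2 \<alpha>\<^sub>2 z') \<ominus>\<^bsub>N\<^esub> (\<alpha>\<^sub>2 x' \<star>\<^sub>2 (y' \<star>\<^sub>2 z'))))"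
  unfolding pure_star_star_twist pure_twist_star_star
  using carr by (simp add: closed pure_diff T.M.minus_cancel_middle)

end

lemma dot_comm_hom_associative: "comm_hom_associative_algebra K T (\<bullet>) \<alpha>"
proof
  show "[n] \<cdot>\<^bsub>K\<^esub> \<one>\<^bsub>K\<^esub> \<noteq> \<zero>\<^bsub>K\<^esub>" if "0 < n" for n :: nat
    using that by (rule A\<^sub>1.char_0)
  show "bilinear_map K T T T (\<bullet>)" by (rule dot_bilinear)
  show "linear_map K T T \<alpha>" by (rule twist_linear)
next
  fix X Y assume XY: "X \<in> carrier T" "Y \<in> carrier T"
  have swap: "bilinear_map K T T T (\<lambda>X Y. Y \<bullet> X)"
    using dot_bilinear by (auto simp: bilinear_map_def)
  show "X \<bullet> Y = Y \<bullet> X"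
    by (rule tensor_ext2[OF T.module_axioms dot_bilinear swap _ XY])
      (simp add: dot_pure A\<^sub>1.commutative A\<^sub>2.commutative)
next
  fix X Y Z assume XYZ: "X \<in> carrier T" "Y \<in> carrier T" "Z \<in> carrier T"
  show "(X \<bullet> Y) \<bullet> \<alpha> Z = \<alpha> X \<bullet> (Y \<bullet> Z)"
    by (rule tensor_ext3[OF T.module_axioms trilinear_map_nest(1,2)[OF dot_bilinear dot_bilinear twist_linear] _ XYZ])
      (simp add: dot_pure twist_pure closed A\<^sub>1.hom_associative A\<^sub>2.hom_associative)
qed

lemma star_hom_novikov: "hom_novikov_algebra K T (\<star>) \<alpha>"
proof
  show "[n] \<cdot>\<^bsub>K\<^esub> \<one>\<^bsub>K\<^esub> \<noteq> \<zero>\<^bsub>K\<^esub>" if "0 < n" for n :: nat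
    using that by (rule A\<^sub>1.char_0)
  show "bilinear_map K T T T (\<star>)" by (rule star_bilinear)
  show "linear_map K T T \<alpha>" by (rule twist_linear)
next
  fix X Y Z assume XYZ: "X \<in> carrier T" "Y \<in> carrier T" "Z \<in> carrier T"
  note nest = trilinear_map_nest[OF star_bilinear star_bilinear twist_linear]
  note assoc = trilinear_map_diff[OF T.module_axioms nest]
  show "((X \<star> Y) \<star> \<alpha> Z) \<ominus>\<^bsub>T\<^esub> (\<alpha> X \<star> (Y \<star> Z)) = ((Y \<star> X) \<star> \<alpha> Z) \<ominus>\<^bsub>T\<^esub> (\<alpha> Y \<star> (X \<star> Z))"
  proof (rule tensor_ext3[OF T.module_axioms assoc trilinear_map_swap12[OF assoc] _ XYZ])
    fix x x' y y' z z'
    assume "x \<in> carrier M" "x' \<in> carrier N" "y \<in> carrier M" "y' \<in> carrier N" "z \<in> carrier M" "z' \<in> carrier N"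
    then show "(((x \<otimes>\<^sub>T x') \<star> (y \<otimes>\<^sub>T y')) \<star> \<alpha> (z \<otimes>\<^sub>T z')) \<ominus>\<^bsub>T\<^esub> (\<alpha> (x \<otimes>\<^sub>T x') \<star> ((y \<otimes>\<^sub>T y') \<star> (z \<otimes>\<^sub>T z'))) =
      (((y \<otimes>\<^sub>T y') \<star> (x \<otimes>\<^sub>T x')) \<star> \<alpha> (z \<otimes>\<^sub>T z')) \<ominus>\<^bsub>T\<^esub> (\<alpha> (y \<otimes>\<^sub>T y') \<star> ((x \<otimes>\<^sub>T x') \<star> (z \<otimes>\<^sub>T z')))"
      using A\<^sub>1.Nov.hom_left_symmetric[of x y z] A\<^sub>2.Nov.hom_left_symmetric[of x' y' z']
        A\<^sub>1.commutative[of x y] A\<^sub>2.commutative[of x' y']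
      by (simp only: pure_associator)
  qed
  show "(X \<star> Y) \<star> \<alpha> Z = (X \<star> Z) \<star> \<alpha> Y"
  proof (rule tensor_ext3[OF T.module_axioms nest(1) trilinear_map_swap23[OF nest(1)] _ XYZ])
    fix x x' y y' z z'
    assume "x \<in> carrier M" "x' \<in> carrier N" "y \<in> carrier M" "y' \<in> carrier N" "z \<in> carrier M" "z' \<in> carrier N"
    then show "((x \<otimes>\<^sub>T x') \<star> (y \<otimes>\<^sub>T y')) \<star> \<alpha> (z \<otimes>\<^sub>T z') = ((x \<otimes>\<^sub>T x') \<star> (z \<otimes>\<^sub>T z')) \<star> \<alpha> (y \<otimes>\<^sub>T y')"
      using A\<^sub>1.Nov.hom_right_commutative[of x y z] A\<^sub>2.Nov.hom_right_commutative[of x' y' z']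
        A\<^sub>1.dot_perm[of x y z] A\<^sub>2.dot_perm[of x' y' z']
        A\<^sub>1.dot_star_perm[of x y z] A\<^sub>2.dot_star_perm[of x' y' z']
      by (simp only: pure_star_star_twist)
  qed
qed

theorem tensor_admissible: "admissible_hom_novikov_poisson_algebra K T (\<bullet>) (\<star>) \<alpha>"
proof (rule admissible_hom_novikov_poisson_algebraI[OF dot_comm_hom_associative star_hom_novikov])
  fix X Y Z assume XYZ: "X \<in> carrier T" "Y \<in> carrier T" "Z \<in> carrier T"
  note dot_of_star = trilinear_map_nest[OF dot_bilinear star_bilinear twist_linear]
  note star_of_dot = trilinear_map_nest[OF star_bilinear dot_bilinear twist_linear]
  show "(X \<star> Y) \<bullet> \<alpha> Z = (X \<bullet> Y) \<star> \<alpha> Z"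
    by (rule tensor_ext3[OF T.module_axioms dot_of_star(1) star_of_dot(1) _ XYZ])
      (simp add: closed dot_pure star_pure twist_pure sum_distrib star_dot_shift)
  show "\<alpha> X \<star> (Y \<bullet> Z) = (X \<bullet> Y) \<star> \<alpha> Z"
    by (rule tensor_ext3[OF T.module_axioms star_of_dot(2,1) _ XYZ])
      (simp add: closed dot_pure star_pure twist_pure star_dot_shift
        A\<^sub>1.hom_associative[symmetric] A\<^sub>2.hom_associative[symmetric])
qed

end

section \<open>Admissibility of the tensor product\<close>

theorem corollary5p9:
  fixes K :: "('k, 'r) ring_scheme"
    and A\<^sub>1 :: "('k, 'a, 'm) module_scheme" and A\<^sub>2 :: "('k, 'b, 'n) module_scheme"
    and dot\<^sub>1 star\<^sub>1 :: "'a \<Rightarrow> 'a \<Rightarrow> 'a" and \<alpha>\<^sub>1 :: "'a \<Rightarrow> 'a"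
    and dot\<^sub>2 star\<^sub>2 :: "'b \<Rightarrow> 'b \<Rightarrow> 'b" and \<alpha>\<^sub>2 :: "'b \<Rightarrow> 'b"
  assumes "admissible_hom_novikov_poisson_algebra K A\<^sub>1 dot\<^sub>1 star\<^sub>1 \<alpha>\<^sub>1"
    and "admissible_hom_novikov_poisson_algebra K A\<^sub>2 dot\<^sub>2 star\<^sub>2 \<alpha>\<^sub>2"
  shows "admissible_hom_novikov_poisson_algebra K (tensor_product K A\<^sub>1 A\<^sub>2)
           (tensor_op K A\<^sub>1 A\<^sub>2 dot\<^sub>1 dot\<^sub>2)
           (tensor_star K A\<^sub>1 A\<^sub>2 dot\<^sub>1 star\<^sub>1 dot\<^sub>2 star\<^sub>2)
           (tensor_map K A\<^sub>1 A\<^sub>2 \<alpha>\<^sub>1 \<alpha>\<^sub>2)"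
proof -
  interpret admissible_pair K A\<^sub>1 A\<^sub>2 dot\<^sub>1 star\<^sub>1 \<alpha>\<^sub>1 dot\<^sub>2 star\<^sub>2 \<alpha>\<^sub>2
    using assms by (simp add: admissible_pair_def)
  show ?thesis by (rule tensor_admissible)
qed

end
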